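(* Let $\mathcal{L}$ be a first-order language and let $\mathcal{K}=(K,\leq,D,\Vdash)$ be a finite-depth Kripke model for $\mathcal{L}$. Then for every $\alpha\in K$ there exists $\rho\in{\sf PEM}_1(\mathcal{L})^*$ such that for every sentence $A$ of $\mathcal{L}(D(\alpha))$, $$\alpha\Vdash A^{\rho}\quad\text{iff}\quad\alpha\models A.$$
   Context: A Kripke model for a first-order language $\mathcal{L}$ is $\mathcal{K}=(K,\leq,D,\Vdash)$ with $(K,\leq)$ a nonempty poset, $D(\alpha)$ nonempty domains increasing along $\leq$, and $\Vdash$ a monotone relation between nodes $\alpha$ and atomic sentences of $\mathcal{L}(D(\alpha))$ ($\mathcal{L}$ with constants for elements of $D(\alpha)$), extended to all sentences in the standard intuitionistic way ($\bot$ never forced; $\wedge,\vee,\exists$ local; $\to$ and $\forall$ quantify over all $\beta\geq\alpha$ and, for $\forall$, all $b\in D(\beta)$). $\alpha\models A$ means $A$ holds in the classical structure at $\alpha$: universe $D(\alpha)$, an atomic sentence true iff forced at $\alpha$. The depth of a Kripke model is the maximum natural number $n$ such that no chain in $(K,\leq)$ is longer than $n$; finite depth means this exists. Friedman translation $A^\rho$ for a sentence $\rho$: replace each atomic subformula $P$ (including $\bot$) by $P\vee\rho$, commuting with $\wedge,\vee,\to,\forall,\exists$; $\neg A$ is $A\to\bot$. ${\sf PEM}(\mathcal{L})$ is the set of universal closures of $A\vee\neg A$ for formulas $A$ of $\mathcal{L}$. The Kripke-rank $h_{\mathcal{L}}(A)$ of a formula $A$ is the least $n$ such that some Kripke model for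 $\mathcal{L}$ of depth $n$ does not force $A$ (it is $\omega$ if $A$ is refuted only by infinite-depth models, $\infty$ if refuted by none). ${\sf PEM}_1(\mathcal{L})=\{A\in{\sf PEM}(\mathcal{L}): h_{\mathcal{L}}(A)=1\}$. For a set $\Gamma$, $\Gamma^*=\bigcup_n\Gamma^n$, $\Gamma^0=\{\bot\}$, $\Gamma^{n+1}=\{A^B:A\in\Gamma^n,B\in\Gamma\}$. *)

theory Defs
  imports Main
begin

section \<open>First-order languages\<close>

datatype 'f trm = Var nat | App 'f "'f trm list"

datatype ('f, 'p) fm =
    Bot
  | Atom 'p "'f trm list"
  | And "('f, 'p) fm" "('f, 'p) fm"
  | Or "('f, 'p) fm" "('f, 'p) fm"
  | Imp "('f, 'p) fm" "('f, 'p) fm"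
  | Forall nat "('f, 'p) fm"
  | Exists nat "('f, 'p) fm"

abbreviation Neg :: "('f, 'p) fm \<Rightarrow> ('f, 'p) fm" where
  "Neg A \<equiv> Imp A Bot"

text \<open>A language consists of function and predicate symbols, each paired with its arity; either set
  may be empty. Equality, if present, is a predicate symbol like any other.\<close>

record ('f, 'p) lang =
  Funs :: "('f \<times> nat) set"
  Preds :: "('p \<times> nat) set"

fun wf_trm :: "('f, 'p) lang \<Rightarrow> 'f trm \<Rightarrow> bool" where
  "wf_trm L (Var x) \<longleftrightarrow> True"
| "wf_trm L (App f ts) \<longleftrightarrow> (f, length ts) \<in> Funs L \<and> (\<forall>t\<in>set ts. wf_trm L t)"

primrec wf_fm :: "('f, 'p) lang \<Rightarrow> ('f, 'p) fm \<Rightarrow> bool" where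
  "wf_fm L Bot \<longleftrightarrow> True"
| "wf_fm L (Atom p ts) \<longleftrightarrow> (p, length ts) \<in> Preds L \<and> (\<forall>t\<in>set ts. wf_trm L t)"
| "wf_fm L (And A B) \<longleftrightarrow> wf_fm L A \<and> wf_fm L B"
| "wf_fm L (Or A B) \<longleftrightarrow> wf_fm L A \<and> wf_fm L B"
| "wf_fm L (Imp A B) \<longleftrightarrow> wf_fm L A \<and> wf_fm L B"
| "wf_fm L (Forall x A) \<longleftrightarrow> wf_fm L A"
| "wf_fm L (Exists x A) \<longleftrightarrow> wf_fm L A"

fun fv_trm :: "'f trm \<Rightarrow> nat set" where
  "fv_trm (Var x) = {x}"
| "fv_trm (App f ts) = (\<Union>t\<in>set ts. fv_trm t)"

primrec fv :: "('f, 'p) fm \<Rightarrow> nat set" where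
  "fv Bot = {}"
| "fv (Atom p ts) = (\<Union>t\<in>set ts. fv_trm t)"
| "fv (And A B) = fv A \<union> fv B"
| "fv (Or A B) = fv A \<union> fv B"
| "fv (Imp A B) = fv A \<union> fv B"
| "fv (Forall x A) = fv A - {x}"
| "fv (Exists x A) = fv A - {x}"

definition sentence :: "('f, 'p) lang \<Rightarrow> ('f, 'p) fm \<Rightarrow> bool" where
  "sentence L A \<longleftrightarrow> wf_fm L A \<and> fv A = {}"

text \<open>\<open>with_consts L C\<close> is the language \<open>L(C)\<close>: the symbols of \<open>L\<close> are tagged by \<open>Inl\<close>, and each
  \<open>c \<in> C\<close> becomes the constant symbol \<open>Inr c\<close>. Accordingly \<open>embed_fm\<close> reads a formula of \<open>L\<close> as a
  formula of \<open>L(C)\<close>.\<close>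

definition with_consts :: "('f, 'p) lang \<Rightarrow> 'd set \<Rightarrow> ('f + 'd, 'p) lang" where
  "with_consts L C =
     \<lparr>Funs = {(Inl f, n) |f n. (f, n) \<in> Funs L} \<union> {(Inr c, 0) |c. c \<in> C}, Preds = Preds L\<rparr>"

definition embed_fm :: "('f, 'p) fm \<Rightarrow> ('f + 'd, 'p) fm" where
  "embed_fm = map_fm Inl id"


section \<open>Kripke models\<close>

record ('f, 'p, 'w, 'd) kripke =
  Nodes :: "'w set"
  Leq :: "('w \<times> 'w) set"
  Dom :: "'w \<Rightarrow> 'd set"
  Fint :: "'w \<Rightarrow> 'f \<Rightarrow> 'd list \<Rightarrow> 'd"
  Forced :: "'w \<Rightarrow> 'p \<Rightarrow> 'd list \<Rightarrow> bool"

text \<open>\<open>Forced M w p ds\<close> says that the atomic sentence \<open>p(d\<^sub>1,\<dots>,d\<^sub>n)\<close> is forced at \<open>w\<close>. Function symbols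
  are interpreted at each node by operations on its domain, extended along the order; a closed
  term of \<open>L(D(w))\<close> thereby denotes an element of \<open>D(w)\<close>.\<close>

definition kripke_model :: "('f, 'p) lang \<Rightarrow> ('f, 'p, 'w, 'd) kripke \<Rightarrow> bool" where
  "kripke_model L M \<longleftrightarrow>
     Nodes M \<noteq> {} \<and>
     partial_order_on (Nodes M) (Leq M) \<and>
     (\<forall>w\<in>Nodes M. Dom M w \<noteq> {}) \<and>
     (\<forall>(w, v)\<in>Leq M. Dom M w \<subseteq> Dom M v) \<and>
     (\<forall>w\<in>Nodes M. \<forall>(f, n)\<in>Funs L. \<forall>ds\<in>lists (Dom M w). length ds = n \<longrightarrow>
        Fint M w f ds \<in> Dom M w) \<and>
     (\<forall>(w, v)\<in>Leq M. \<forall>(f, n)\<in>Funs L. \<forall>ds\<in>lists (Dom M w). length ds = n \<longrightarrow>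
        Fint M v f ds = Fint M w f ds) \<and>
     (\<forall>(w, v)\<in>Leq M. \<forall>(p, n)\<in>Preds L. \<forall>ds\<in>lists (Dom M w). length ds = n \<longrightarrow>
        Forced M w p ds \<longrightarrow> Forced M v p ds)"

fun val :: "('f, 'p, 'w, 'd) kripke \<Rightarrow> 'w \<Rightarrow> (nat \<Rightarrow> 'd) \<Rightarrow> ('f + 'd) trm \<Rightarrow> 'd" where
  "val M w e (Var x) = e x"
| "val M w e (App (Inl f) ts) = Fint M w f (map (val M w e) ts)"
| "val M w e (App (Inr d) ts) = d"

primrec force :: "('f, 'p, 'w, 'd) kripke \<Rightarrow> 'w \<Rightarrow> (nat \<Rightarrow> 'd) \<Rightarrow> ('f + 'd, 'p) fm \<Rightarrow> bool" where
  "force M w e Bot \<longleftrightarrow> False"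
| "force M w e (Atom p ts) \<longleftrightarrow> Forced M w p (map (val M w e) ts)"
| "force M w e (And A B) \<longleftrightarrow> force M w e A \<and> force M w e B"
| "force M w e (Or A B) \<longleftrightarrow> force M w e A \<or> force M w e B"
| "force M w e (Imp A B) \<longleftrightarrow> (\<forall>v. (w, v) \<in> Leq M \<longrightarrow> force M v e A \<longrightarrow> force M v e B)"
| "force M w e (Forall x A) \<longleftrightarrow>
     (\<forall>v. (w, v) \<in> Leq M \<longrightarrow> (\<forall>b\<in>Dom M v. force M v (e(x := b)) A))"
| "force M w e (Exists x A) \<longleftrightarrow> (\<exists>b\<in>Dom M w. force M w (e(x := b)) A)"

primrec holds :: "('f, 'p, 'w, 'd) kripke \<Rightarrow> 'w \<Rightarrow> (nat \<Rightarrow> 'd) \<Rightarrow> ('f + 'd, 'p) fm \<Rightarrow> bool" where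
  "holds M w e Bot \<longleftrightarrow> False"
| "holds M w e (Atom p ts) \<longleftrightarrow> Forced M w p (map (val M w e) ts)"
| "holds M w e (And A B) \<longleftrightarrow> holds M w e A \<and> holds M w e B"
| "holds M w e (Or A B) \<longleftrightarrow> holds M w e A \<or> holds M w e B"
| "holds M w e (Imp A B) \<longleftrightarrow> (holds M w e A \<longrightarrow> holds M w e B)"
| "holds M w e (Forall x A) \<longleftrightarrow> (\<forall>b\<in>Dom M w. holds M w (e(x := b)) A)"
| "holds M w e (Exists x A) \<longleftrightarrow> (\<exists>b\<in>Dom M w. holds M w (e(x := b)) A)"

text \<open>For a sentence the assignment is irrelevant (and some assignment into \<open>D(w)\<close> exists, as
  domains are nonempty). A model forces an open formula,
  i.e. its universal closure, iff every node forces it under every assignment into its domain.\<close>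

definition forces :: "('f, 'p, 'w, 'd) kripke \<Rightarrow> 'w \<Rightarrow> ('f + 'd, 'p) fm \<Rightarrow> bool" where
  "forces M w A \<longleftrightarrow> (\<forall>e. range e \<subseteq> Dom M w \<longrightarrow> force M w e A)"

definition models_at :: "('f, 'p, 'w, 'd) kripke \<Rightarrow> 'w \<Rightarrow> ('f + 'd, 'p) fm \<Rightarrow> bool" where
  "models_at M w A \<longleftrightarrow> (\<forall>e. range e \<subseteq> Dom M w \<longrightarrow> holds M w e A)"

text \<open>The length of a chain \<open>w\<^sub>0 < \<dots> < w\<^sub>n\<close> is \<open>n\<close>, so that the models of depth 0 are the disjoint
  unions of classical structures.\<close>

definition has_depth :: "('f, 'p, 'w, 'd) kripke \<Rightarrow> nat \<Rightarrow> bool" where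
  "has_depth M n \<longleftrightarrow>
     (\<exists>C\<in>Chains (Leq M). finite C \<and> card C = Suc n) \<and>
     (\<forall>C\<in>Chains (Leq M). finite C \<and> card C \<le> Suc n)"

definition finite_depth :: "('f, 'p, 'w, 'd) kripke \<Rightarrow> bool" where
  "finite_depth M \<longleftrightarrow> (\<exists>n. has_depth M n)"


section \<open>Kripke-rank and the Friedman translation\<close>

text \<open>The Kripke-rank refers to all Kripke models for \<open>L\<close>. By the downward Loewenheim-Skolem argument
  (choosing witnesses for non-forced implications and universal formulas and for forced
  existential ones), a model refuting \<open>A\<close> has a refuting submodel, on a suborder and hence of no
  larger depth, whose sets of nodes and of individuals have cardinality at most that of the set
  of formulas over the given symbols. So it suffices to let nodes and individuals range over the
  type of formulas.\<close>

type_synonym ('f, 'p) small_kripke = "('f, 'p, ('f, 'p) fm, ('f, 'p) fm) kripke"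

definition refutes :: "('f, 'p, 'w, 'd) kripke \<Rightarrow> ('f, 'p) fm \<Rightarrow> bool" where
  "refutes M A \<longleftrightarrow> (\<exists>w\<in>Nodes M. \<not> forces M w (embed_fm A))"

datatype krank = Fin nat | Omega | Infty

definition kripke_rank :: "('f, 'p) lang \<Rightarrow> ('f, 'p) fm \<Rightarrow> krank" where
  "kripke_rank L A =
     (if \<exists>n. \<exists>M::('f, 'p) small_kripke. kripke_model L M \<and> has_depth M n \<and> refutes M A
      then Fin (LEAST n. \<exists>M::('f, 'p) small_kripke. kripke_model L M \<and> has_depth M n \<and> refutes M A)
      else if \<exists>M::('f, 'p) small_kripke. kripke_model L M \<and> refutes M A
      then Omega
      else Infty)"

definition PEM :: "('f, 'p) lang \<Rightarrow> ('f, 'p) fm set" where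
  "PEM L = {foldr Forall xs (Or A (Neg A)) |A xs. wf_fm L A \<and> distinct xs \<and> set xs = fv A}"

definition PEM1 :: "('f, 'p) lang \<Rightarrow> ('f, 'p) fm set" where
  "PEM1 L = {A \<in> PEM L. kripke_rank L A = Fin 1}"

text \<open>\<open>friedman A \<rho>\<close> is \<open>A\<^sup>\<rho>\<close>. Only sentences \<open>\<rho>\<close> are substituted, so no variable is captured.\<close>

primrec friedman :: "('f, 'p) fm \<Rightarrow> ('f, 'p) fm \<Rightarrow> ('f, 'p) fm" where
  "friedman Bot \<rho> = Or Bot \<rho>"
| "friedman (Atom p ts) \<rho> = Or (Atom p ts) \<rho>"
| "friedman (And A B) \<rho> = And (friedman A \<rho>) (friedman B \<rho>)"
| "friedman (Or A B) \<rho> = Or (friedman A \<rho>) (friedman B \<rho>)"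
| "friedman (Imp A B) \<rho> = Imp (friedman A \<rho>) (friedman B \<rho>)"
| "friedman (Forall x A) \<rho> = Forall x (friedman A \<rho>)"
| "friedman (Exists x A) \<rho> = Exists x (friedman A \<rho>)"

primrec friedman_pow :: "('f, 'p) fm set \<Rightarrow> nat \<Rightarrow> ('f, 'p) fm set" where
  "friedman_pow \<Gamma> 0 = {Bot}"
| "friedman_pow \<Gamma> (Suc n) = {friedman A B |A B. A \<in> friedman_pow \<Gamma> n \<and> B \<in> \<Gamma>}"

definition friedman_star :: "('f, 'p) fm set \<Rightarrow> ('f, 'p) fm set" where
  "friedman_star \<Gamma> = (\<Union>n. friedman_pow \<Gamma> n)"

end

theory Submission imports Defs begin

text \<open>Passing from \<open>A\<close> to \<open>A\<^sup>\<rho>\<close> amounts to deleting from the model all nodes that force \<open>\<rho>\<close>, and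
  iterated translations delete iteratively. A node forcing every instance of PEM forces exactly
  what is true at it, so it suffices to delete nodes above \<open>\<alpha>\<close>, keeping \<open>\<alpha>\<close>, until \<open>\<alpha>\<close> forces PEM.
  If \<open>\<alpha>\<close> does not, let \<open>\<beta> \<ge> \<alpha>\<close> be maximal among the nodes not forcing PEM, and \<open>B\<close> an instance not
  forced at \<open>\<beta>\<close>. All proper successors of \<open>\<beta>\<close> are classical, so the order above \<open>\<beta>\<close> may be flattened
  to depth 1 without affecting \<open>\<beta>\<close>; hence \<open>B\<close> has Kripke-rank 1 (a Skolem hull provides a
  refuting model of the size demanded by the definition of the rank). Deleting the nodes that
  force \<open>B\<close> removes all maximal nodes, so that chains get shorter, but not \<open>\<alpha>\<close>.\<close>

section \<open>Formulas and forcing\<close>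

lemma embed_fm_simps [simp]:
  "embed_fm Bot = Bot"
  "embed_fm (Atom p ts) = Atom p (map (map_trm Inl) ts)"
  "embed_fm (And A B) = And (embed_fm A) (embed_fm B)"
  "embed_fm (Or A B) = Or (embed_fm A) (embed_fm B)"
  "embed_fm (Imp A B) = Imp (embed_fm A) (embed_fm B)"
  "embed_fm (Forall x A) = Forall x (embed_fm A)"
  "embed_fm (Exists x A) = Exists x (embed_fm A)"
  by (simp_all add: embed_fm_def)

lemma embed_fm_foldr_Forall [simp]:
  "embed_fm (foldr Forall xs A) = foldr Forall xs (embed_fm A)"
  by (induction xs) simp_all

lemma embed_fm_friedman: "embed_fm (friedman A \<rho>) = friedman (embed_fm A) (embed_fm \<rho>)"
  by (induction A) simp_all

lemma fv_trm_map_trm [simp]: "fv_trm (map_trm h t) = fv_trm t"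
  by (induction t) auto

lemma fv_embed_fm [simp]: "fv (embed_fm A) = fv A"
  by (induction A) auto

lemma finite_fv_trm: "finite (fv_trm t)"
  by (induction t) auto

lemma finite_fv: "finite (fv A)"
  by (induction A) (auto simp: finite_fv_trm)

lemma fv_foldr_Forall: "fv (foldr Forall xs A) = fv A - set xs"
  by (induction xs) auto

lemma wf_fm_foldr_Forall [simp]: "wf_fm L (foldr Forall xs A) = wf_fm L A"
  by (induction xs) auto

lemma fv_friedman: "fv (friedman A \<rho>) \<subseteq> fv A \<union> fv \<rho>"
  by (induction A) auto

lemma wf_fm_friedman: "wf_fm L A \<Longrightarrow> wf_fm L \<rho> \<Longrightarrow> wf_fm L (friedman A \<rho>)"
  by (induction A) auto

lemma sentence_friedman: "sentence L A \<Longrightarrow> sentence L \<rho> \<Longrightarrow> sentence L (friedman A \<rho>)"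
  using fv_friedman[of A \<rho>] by (auto simp: sentence_def wf_fm_friedman)

lemma sentence_PEM: "B \<in> PEM L \<Longrightarrow> sentence L B"
  by (auto simp: PEM_def sentence_def fv_foldr_Forall)

section \<open>Independence of forcing from irrelevant variables\<close>

lemma val_cong: "(\<And>x. x \<in> fv_trm t \<Longrightarrow> e x = e' x) \<Longrightarrow> val M w e t = val M w e' t"
proof (induction t)
  case (App f ts)
  then have "map (val M w e) ts = map (val M w e') ts"
    by auto
  then show ?case
    by (cases f) (simp_all del: map_eq_conv)
qed simp

lemma map_val_cong:
  "(\<And>x. x \<in> (\<Union>t\<in>set ts. fv_trm t) \<Longrightarrow> e x = e' x) \<Longrightarrow> map (val M w e) ts = map (val M w e') ts"
  by (auto intro!: val_cong)

lemma force_cong: "(\<And>x. x \<in> fv A \<Longrightarrow> e x = e' x) \<Longrightarrow> force M w e A = force M w e' A"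
proof (induction A arbitrary: w e e')
  case (Atom p ts)
  then have "map (val M w e) ts = map (val M w e') ts"
    by (intro map_val_cong) auto
  then show ?case
    by (simp del: map_eq_conv)
next
  case (And A B)
  have "force M w e A = force M w e' A" "force M w e B = force M w e' B" for w
    by (rule And.IH; simp add: And.prems)+
  then show ?case by simp
next
  case (Or A B)
  have "force M w e A = force M w e' A" "force M w e B = force M w e' B" for w
    by (rule Or.IH; simp add: Or.prems)+
  then show ?case by simp
next
  case (Imp A B)
  have "force M w e A = force M w e' A" "force M w e B = force M w e' B" for w
    by (rule Imp.IH; simp add: Imp.prems)+
  then show ?case by simp
next
  case (Forall x A)
  have "force M v (e(x := b)) A = force M v (e'(x := b)) A" for v b
    by (rule Forall.IH) (simp add: Forall.prems)
  then show ?case by simp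
next
  case (Exists x A)
  have "force M v (e(x := b)) A = force M v (e'(x := b)) A" for v b
    by (rule Exists.IH) (simp add: Exists.prems)
  then show ?case by simp
qed simp

lemma force_closed: "fv A = {} \<Longrightarrow> force M w e A = force M w e' A"
  by (rule force_cong) simp

section \<open>Consequences of the definition of a Kripke model\<close>

lemma kripke_model_po: "kripke_model L M \<Longrightarrow> partial_order_on (Nodes M) (Leq M)"
  by (simp add: kripke_model_def)

lemma kripke_model_refl: "kripke_model L M \<Longrightarrow> w \<in> Nodes M \<Longrightarrow> (w, w) \<in> Leq M"
  by (auto simp: kripke_model_def partial_order_on_def preorder_on_def refl_on_def)

lemma kripke_model_trans:
  "kripke_model L M \<Longrightarrow> (u, v) \<in> Leq M \<Longrightarrow> (v, w) \<in> Leq M \<Longrightarrow> (u, w) \<in> Leq M"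
  by (auto simp: kripke_model_def partial_order_on_def preorder_on_def dest: transD)

lemma kripke_model_antisym:
  "kripke_model L M \<Longrightarrow> (u, v) \<in> Leq M \<Longrightarrow> (v, u) \<in> Leq M \<Longrightarrow> u = v"
  by (auto simp: kripke_model_def partial_order_on_def dest: antisymD)

lemma kripke_model_Leq_Nodes:
  assumes "kripke_model L M" "(u, v) \<in> Leq M"
  shows "u \<in> Nodes M" "v \<in> Nodes M"
  using assms by (auto simp: kripke_model_def partial_order_on_def preorder_on_def refl_on_def)

lemma kripke_model_Dom_mono: "kripke_model L M \<Longrightarrow> (u, v) \<in> Leq M \<Longrightarrow> Dom M u \<subseteq> Dom M v"
  by (auto simp: kripke_model_def)

lemma kripke_model_Dom_nonempty: "kripke_model L M \<Longrightarrow> u \<in> Nodes M \<Longrightarrow> Dom M u \<noteq> {}"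
  by (auto simp: kripke_model_def)

lemma kripke_model_Fint:
  assumes "kripke_model L M" "w \<in> Nodes M" "(f, length ds) \<in> Funs L" "set ds \<subseteq> Dom M w"
  shows "Fint M w f ds \<in> Dom M w"
proof -
  have "\<forall>w\<in>Nodes M. \<forall>(f, n)\<in>Funs L. \<forall>ds\<in>lists (Dom M w). length ds = n \<longrightarrow>
      Fint M w f ds \<in> Dom M w"
    using assms(1) by (simp add: kripke_model_def)
  from bspec[OF bspec[OF this assms(2)] assms(3)] assms(4) show ?thesis
    by (auto simp: in_lists_conv_set)
qed

lemma kripke_model_Fint_mono:
  assumes "kripke_model L M" "(w, v) \<in> Leq M" "(f, length ds) \<in> Funs L" "set ds \<subseteq> Dom M w"
  shows "Fint M v f ds = Fint M w f ds"
proof -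
  have "\<forall>(w, v)\<in>Leq M. \<forall>(f, n)\<in>Funs L. \<forall>ds\<in>lists (Dom M w). length ds = n \<longrightarrow>
      Fint M v f ds = Fint M w f ds"
    using assms(1) by (simp add: kripke_model_def)
  from bspec[OF bspec[OF this assms(2), simplified] assms(3)] assms(4) show ?thesis
    by (auto simp: in_lists_conv_set)
qed

lemma kripke_model_Forced_mono:
  assumes "kripke_model L M" "(w, v) \<in> Leq M" "(p, length ds) \<in> Preds L" "set ds \<subseteq> Dom M w"
    and "Forced M w p ds"
  shows "Forced M v p ds"
proof -
  have "\<forall>(w, v)\<in>Leq M. \<forall>(p, n)\<in>Preds L. \<forall>ds\<in>lists (Dom M w). length ds = n \<longrightarrow>
      Forced M w p ds \<longrightarrow> Forced M v p ds"
    using assms(1) by (simp add: kripke_model_def)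
  from bspec[OF bspec[OF this assms(2), simplified] assms(3)] assms(4,5) show ?thesis
    by (auto simp: in_lists_conv_set)
qed

lemma kripke_modelI:
  assumes "Nodes M \<noteq> {}" "partial_order_on (Nodes M) (Leq M)"
    and "\<And>w. w \<in> Nodes M \<Longrightarrow> Dom M w \<noteq> {}"
    and "\<And>w v. (w, v) \<in> Leq M \<Longrightarrow> Dom M w \<subseteq> Dom M v"
    and "\<And>w f ds. w \<in> Nodes M \<Longrightarrow> (f, length ds) \<in> Funs L \<Longrightarrow> set ds \<subseteq> Dom M w \<Longrightarrow>
      Fint M w f ds \<in> Dom M w"
    and "\<And>w v f ds. (w, v) \<in> Leq M \<Longrightarrow> (f, length ds) \<in> Funs L \<Longrightarrow> set ds \<subseteq> Dom M w \<Longrightarrow>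
      Fint M v f ds = Fint M w f ds"
    and "\<And>w v p ds. (w, v) \<in> Leq M \<Longrightarrow> (p, length ds) \<in> Preds L \<Longrightarrow> set ds \<subseteq> Dom M w \<Longrightarrow>
      Forced M w p ds \<Longrightarrow> Forced M v p ds"
  shows "kripke_model L M"
  unfolding kripke_model_def
proof (intro conjI ballI)
  show "Nodes M \<noteq> {}" "partial_order_on (Nodes M) (Leq M)"
    by (rule assms)+
qed (use assms(3-7) in \<open>auto simp: in_lists_conv_set subset_iff\<close>)

section \<open>Persistence of values and of forcing\<close>

lemma val_in_Dom:
  assumes "kripke_model L M" "w \<in> Nodes M" "range e \<subseteq> Dom M w" "wf_trm L t"
  shows "val M w e (map_trm Inl t) \<in> Dom M w"
  using assms(4)
proof (induction t)
  case (Var x)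
  then show ?case using assms(3) by auto
next
  case (App f ts)
  then show ?case
    using assms by (auto intro!: kripke_model_Fint simp: o_def)
qed

lemma val_mono:
  assumes "kripke_model L M" "(w, v) \<in> Leq M" "range e \<subseteq> Dom M w" "wf_trm L t"
  shows "val M v e (map_trm Inl t) = val M w e (map_trm Inl t)"
  using assms(4)
proof (induction t)
  case (App f ts)
  then have eq: "map (val M v e) (map (map_trm Inl) ts) = map (val M w e) (map (map_trm Inl) ts)"
    by auto
  have "Fint M v f (map (val M w e) (map (map_trm Inl) ts))
      = Fint M w f (map (val M w e) (map (map_trm Inl) ts))"
    using App.prems assms kripke_model_Leq_Nodes(1)[OF assms(1,2)]
    by (intro kripke_model_Fint_mono) (auto intro!: val_in_Dom)
  then show ?case using eq by (simp del: map_map map_eq_conv)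
qed simp

lemma range_fun_upd: "range e \<subseteq> D \<Longrightarrow> b \<in> D \<Longrightarrow> range (e(x := b)) \<subseteq> D"
  by auto

lemma force_mono:
  assumes "kripke_model L M"
  shows "(w, v) \<in> Leq M \<Longrightarrow> range e \<subseteq> Dom M w \<Longrightarrow> wf_fm L A \<Longrightarrow>
    force M w e (embed_fm A) \<Longrightarrow> force M v e (embed_fm A)"
proof (induction A arbitrary: e)
  case (Atom p ts)
  have eq: "map (val M v e) (map (map_trm Inl) ts) = map (val M w e) (map (map_trm Inl) ts)"
    using val_mono[OF assms Atom.prems(1,2)] Atom.prems(3) by auto
  have "Forced M v p (map (val M w e) (map (map_trm Inl) ts))"
    using Atom.prems assms kripke_model_Leq_Nodes(1)[OF assms Atom.prems(1)]
    by (intro kripke_model_Forced_mono[OF assms Atom.prems(1)]) (auto intro!: val_in_Dom)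
  then show ?case using eq by (simp del: map_map map_eq_conv)
next
  case (Imp A B)
  then show ?case using kripke_model_trans[OF assms Imp.prems(1)] by auto
next
  case (Forall x A)
  then show ?case using kripke_model_trans[OF assms Forall.prems(1)] by auto
next
  case (Exists x A)
  from Exists.prems(4) obtain b where b: "b \<in> Dom M w" "force M w (e(x := b)) (embed_fm A)"
    by auto
  have "wf_fm L A"
    using Exists.prems(3) by simp
  then have "force M v (e(x := b)) (embed_fm A)"
    by (rule Exists.IH[OF Exists.prems(1) range_fun_upd[OF Exists.prems(2) b(1)] _ b(2)])
  then show ?case
    using b kripke_model_Dom_mono[OF assms Exists.prems(1)] by auto
qed auto

text \<open>Neither \<open>e\<close> nor \<open>e'\<close> need take values in a domain; since the
  formula is closed, a constant assignment into \<open>Dom M w\<close> mediates between them and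
  makes \<open>force_mono\<close> applicable.\<close>

lemma sentence_force_mono:
  assumes "kripke_model L M" "sentence L A" "(w, v) \<in> Leq M" "force M w e (embed_fm A)"
  shows "force M v e' (embed_fm A)"
proof -
  obtain d where d: "d \<in> Dom M w"
    using kripke_model_Dom_nonempty[OF assms(1) kripke_model_Leq_Nodes(1)[OF assms(1,3)]] by auto
  have cl: "fv (embed_fm A) = {}"
    using assms(2) by (simp add: sentence_def)
  have "force M w (\<lambda>_. d) (embed_fm A)"
    using assms(4) force_closed[OF cl, of M w e "\<lambda>_. d"] by simp
  then have "force M v (\<lambda>_. d) (embed_fm A)"
    using force_mono[OF assms(1,3), of "\<lambda>_. d" A] d assms(2) by (auto simp: sentence_def)
  then show ?thesis
    using force_closed[OF cl, of M v e' "\<lambda>_. d"] by simp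
qed

text \<open>Each quantifier of the prefix moves to a later node and resets one variable. By
  transitivity the moves combine into a single one; for the empty prefix, persistence accounts for
  the quantification over \<open>v\<close>.\<close>

lemma force_foldr_Forall:
  assumes "kripke_model L M" "wf_fm L A"
  shows "w \<in> Nodes M \<Longrightarrow> range e \<subseteq> Dom M w \<Longrightarrow>
    force M w e (embed_fm (foldr Forall xs A)) \<longleftrightarrow>
    (\<forall>v e'. (w, v) \<in> Leq M \<longrightarrow> range e' \<subseteq> Dom M v \<longrightarrow> (\<forall>x. x \<notin> set xs \<longrightarrow> e' x = e x) \<longrightarrow>
      force M v e' (embed_fm A))"
proof (induction xs arbitrary: w e)
  case Nil
  have eq: "(\<forall>x. x \<notin> set [] \<longrightarrow> e' x = e x) \<longleftrightarrow> e' = e" for e'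
    by auto
  have "force M w e (embed_fm A) \<longleftrightarrow> (\<forall>v. (w, v) \<in> Leq M \<longrightarrow> force M v e (embed_fm A))"
    using force_mono[OF assms(1) _ Nil(2) assms(2)] kripke_model_refl[OF assms(1) Nil(1)] by blast
  moreover have "range e \<subseteq> Dom M v" if "(w, v) \<in> Leq M" for v
    using kripke_model_Dom_mono[OF assms(1) that] Nil(2) by (rule order_trans[rotated])
  ultimately show ?case
    unfolding eq foldr.simps id_apply by blast
next
  case (Cons x xs)
  have rng: "range (e(x := b)) \<subseteq> Dom M v" if "(w, v) \<in> Leq M" "b \<in> Dom M v" for v b
    using that Cons.prems kripke_model_Dom_mono[OF assms(1) that(1)] by auto
  have "force M w e (embed_fm (foldr Forall (x # xs) A)) \<longleftrightarrow>
    (\<forall>v. (w, v) \<in> Leq M \<longrightarrow> (\<forall>b\<in>Dom M v. \<forall>u e'. (v, u) \<in> Leq M \<longrightarrow> range e' \<subseteq> Dom M u \<longrightarrow>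
      (\<forall>y. y \<notin> set xs \<longrightarrow> e' y = (e(x := b)) y) \<longrightarrow> force M u e' (embed_fm A)))"
    using Cons.IH[OF kripke_model_Leq_Nodes(2)[OF assms(1)] rng]
    by (simp del: fun_upd_apply cong: ball_cong)
  also have "\<dots> \<longleftrightarrow> (\<forall>v e'. (w, v) \<in> Leq M \<longrightarrow> range e' \<subseteq> Dom M v \<longrightarrow>
      (\<forall>y. y \<notin> set (x # xs) \<longrightarrow> e' y = e y) \<longrightarrow> force M v e' (embed_fm A))"
    (is "?l \<longleftrightarrow> ?r")
  proof
    assume l: ?l
    show ?r
    proof (intro allI impI)
      fix v e'
      assume v: "(w, v) \<in> Leq M" "range e' \<subseteq> Dom M v" "\<forall>y. y \<notin> set (x # xs) \<longrightarrow> e' y = e y"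
      \<comment> \<open>All moves are made at once: the quantifier on \<open>x\<close> goes straight
        to \<open>v\<close> with the value \<open>e' x\<close>, and the remaining ones stay there by
        reflexivity.\<close>
      have "e' x \<in> Dom M v" "(v, v) \<in> Leq M" "\<forall>y. y \<notin> set xs \<longrightarrow> e' y = (e(x := e' x)) y"
        using v kripke_model_refl[OF assms(1)] kripke_model_Leq_Nodes[OF assms(1)] by auto
      then show "force M v e' (embed_fm A)"
        using l v by blast
    qed
  next
    assume r: ?r
    show ?l
    proof (intro allI impI ballI)
      fix v b u e'
      assume v: "(w, v) \<in> Leq M" "b \<in> Dom M v" "(v, u) \<in> Leq M" "range e' \<subseteq> Dom M u"
        "\<forall>y. y \<notin> set xs \<longrightarrow> e' y = (e(x := b)) y"
      have "(w, u) \<in> Leq M" "\<forall>y. y \<notin> set (x # xs) \<longrightarrow> e' y = e y"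
        using v kripke_model_trans[OF assms(1)] by auto
      then show "force M u e' (embed_fm A)"
        using r v(4) by blast
    qed
  qed
  finally show ?case .
qed

lemma force_universal_closure:
  fixes M :: "('f, 'p, 'w, 'd) kripke"
  assumes "kripke_model L M" "wf_fm L A" "w \<in> Nodes M" "set xs = fv A"
  shows "force M w e (embed_fm (foldr Forall xs A)) \<longleftrightarrow>
    (\<forall>v e'. (w, v) \<in> Leq M \<longrightarrow> range e' \<subseteq> Dom M v \<longrightarrow> force M v e' (embed_fm A))"
proof -
  obtain d where d: "d \<in> Dom M w"
    using kripke_model_Dom_nonempty[OF assms(1,3)] by auto
  have cl: "fv (embed_fm (foldr Forall xs A)) = {}"
    using assms(4) by (simp only: fv_embed_fm fv_foldr_Forall) simp
  have "force M w e (embed_fm (foldr Forall xs A)) \<longleftrightarrow>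
      force M w (\<lambda>_. d) (embed_fm (foldr Forall xs A))"
    by (rule force_closed[OF cl])
  also have "\<dots> \<longleftrightarrow> (\<forall>v e'. (w, v) \<in> Leq M \<longrightarrow> range e' \<subseteq> Dom M v \<longrightarrow>
      (\<forall>x. x \<notin> set xs \<longrightarrow> e' x = d) \<longrightarrow> force M v e' (embed_fm A))"
    using d by (intro force_foldr_Forall[OF assms(1-3)]) auto
  also have "\<dots> \<longleftrightarrow> (\<forall>v e'. (w, v) \<in> Leq M \<longrightarrow> range e' \<subseteq> Dom M v \<longrightarrow>
      force M v e' (embed_fm A))" (is "?l \<longleftrightarrow> ?r")
  proof
    assume l: ?l
    show ?r
    proof (intro allI impI)
      fix v and e' :: "nat \<Rightarrow> 'd"
      assume v: "(w, v) \<in> Leq M" "range e' \<subseteq> Dom M v"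
      \<comment> \<open>Outside \<open>xs\<close>, that is outside the free variables of
        \<open>A\<close>, the assignment is reset to \<open>d\<close> to meet the side
        condition.\<close>
      let ?e = "\<lambda>x. if x \<in> set xs then e' x else d"
      have "range ?e \<subseteq> Dom M v"
        using v d kripke_model_Dom_mono[OF assms(1) v(1)] by auto
      then have "force M v ?e (embed_fm A)"
        using l v by auto
      moreover have "force M v ?e (embed_fm A) = force M v e' (embed_fm A)"
        by (rule force_cong) (simp add: assms(4))
      ultimately show "force M v e' (embed_fm A)"
        by simp
    qed
  qed blast
  finally show ?thesis .
qed

section \<open>Classical nodes\<close>

lemma force_eq_holds_at_end_node:
  assumes "\<And>v. (w, v) \<in> Leq M \<longleftrightarrow> v = w"
  shows "force M w e A = holds M w e A"
  by (induction A arbitrary: e) (auto simp: assms)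

text \<open>Without proper successors, failing to force \<open>A\<close> already amounts to forcing
  \<open>Neg A\<close>.\<close>

lemma end_node_forces_PEM:
  assumes "kripke_model L M" "w \<in> Nodes M" "B \<in> PEM L" "\<And>v. (w, v) \<in> Leq M \<longleftrightarrow> v = w"
  shows "force M w e (embed_fm B)"
proof -
  obtain A xs where B: "B = foldr Forall xs (Or A (Neg A))" "wf_fm L A" "set xs = fv A"
    using assms(3) by (auto simp: PEM_def)
  show ?thesis
    unfolding B(1) using B assms(2)
    by (subst force_universal_closure[OF assms(1)]) (auto simp: assms(4))
qed

text \<open>Stated through PEM rather than as agreement of \<open>force\<close> with
  \<open>holds\<close>, so that a node violating it supplies an instance by which to cut. Instances
  are sentences, hence every \<open>e\<close> gives the same condition.\<close>

definition classical_node :: "('f, 'p) lang \<Rightarrow> ('f, 'p, 'w, 'd) kripke \<Rightarrow> 'w \<Rightarrow> bool" where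
  "classical_node L M w \<longleftrightarrow> (\<forall>B\<in>PEM L. \<forall>e. force M w e (embed_fm B))"

text \<open>The universal closure of \<open>Or A (Neg A)\<close>, forced at \<open>w\<close>,
  decides \<open>A\<close> at every \<open>v\<close> above \<open>w\<close>. What is not forced at
  \<open>v\<close> thus has its negation forced there and remains unforced further up.\<close>

lemma classical_nodeD:
  assumes "kripke_model L M" "w \<in> Nodes M" "classical_node L M w" "wf_fm L A" "(w, v) \<in> Leq M"
    and "range e \<subseteq> Dom M v" "\<not> force M v e (embed_fm A)" "(v, u) \<in> Leq M"
  shows "\<not> force M u e (embed_fm A)"
proof -
  obtain xs where xs: "distinct xs" "set xs = fv A"
    using finite_distinct_list[OF finite_fv[of A]] by blast
  let ?D = "Or A (Neg A)"
  have "foldr Forall xs ?D \<in> PEM L"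
    unfolding PEM_def using assms(4) xs by blast
  then have "force M w e (embed_fm (foldr Forall xs ?D))"
    using assms(3) unfolding classical_node_def by blast
  then have "force M v e (embed_fm ?D)"
    using force_universal_closure[OF assms(1) _ assms(2), of ?D xs e] xs assms(4-6) by auto
  then show ?thesis using assms(7,8) by auto
qed

text \<open>Only \<open>Imp\<close> and \<open>Forall\<close> look beyond \<open>w\<close>. There
  \<open>classical_nodeD\<close> carries failures of forcing upwards, as \<open>force_mono\<close>
  carries forcing.\<close>

lemma classical_node_force_eq_holds:
  assumes M: "kripke_model L M" "w \<in> Nodes M" "classical_node L M w"
  shows "wf_fm L A \<Longrightarrow> range e \<subseteq> Dom M w \<Longrightarrow>
    force M w e (embed_fm A) = holds M w e (embed_fm A)"
proof (induction A arbitrary: e)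
  case (Imp A B)
  have w: "(w, w) \<in> Leq M"
    by (rule kripke_model_refl[OF M(1,2)])
  have IH: "force M w e (embed_fm A) = holds M w e (embed_fm A)"
    "force M w e (embed_fm B) = holds M w e (embed_fm B)"
    using Imp by simp_all
  show ?case
  proof
    assume "force M w e (embed_fm (Imp A B))"
    then show "holds M w e (embed_fm (Imp A B))"
      using IH w by auto
  next
    assume h: "holds M w e (embed_fm (Imp A B))"
    show "force M w e (embed_fm (Imp A B))"
    proof (cases "force M w e (embed_fm A)")
      case True
      then have "force M w e (embed_fm B)"
        using h IH by simp
      then show ?thesis
        using force_mono[OF M(1) _ Imp.prems(2), of _ B] Imp.prems(1) by auto
    next
      case False
      then show ?thesis
        using classical_nodeD[OF M, of A w e] Imp.prems w by auto
    qed
  qed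
next
  case (Forall x A)
  have w: "(w, w) \<in> Leq M"
    by (rule kripke_model_refl[OF M(1,2)])
  have IH: "force M w (e(x := b)) (embed_fm A) = holds M w (e(x := b)) (embed_fm A)"
    if "b \<in> Dom M w" for b
    using that Forall.prems by (intro Forall.IH) auto
  show ?case
  proof
    assume "force M w e (embed_fm (Forall x A))"
    then show "holds M w e (embed_fm (Forall x A))"
      using IH w by simp
  next
    assume h: "holds M w e (embed_fm (Forall x A))"
    \<comment> \<open>The induction hypothesis says nothing about individuals that are new above
      \<open>w\<close>. The failure of \<open>?E\<close> at \<open>w\<close> persists, and at
      \<open>v\<close> it excludes any counterexample to \<open>A\<close>, because \<open>A\<close>
      is decided there.\<close>
    let ?E = "Exists x (Neg A)"
    have "\<not> force M w e (embed_fm ?E)"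
      using h IH w by auto
    then have nE: "\<not> force M v e (embed_fm ?E)" if "(w, v) \<in> Leq M" for v
      using classical_nodeD[OF M, of ?E w e v] Forall.prems w that by auto
    have "force M v (e(x := b)) (embed_fm A)" if v: "(w, v) \<in> Leq M" and b: "b \<in> Dom M v" for v b
    proof (rule ccontr)
      assume "\<not> force M v (e(x := b)) (embed_fm A)"
      moreover have "range (e(x := b)) \<subseteq> Dom M v"
        using b Forall.prems kripke_model_Dom_mono[OF M(1) v] by auto
      ultimately have "force M v (e(x := b)) (embed_fm (Neg A))"
        using classical_nodeD[OF M, of A v "e(x := b)"] Forall.prems v by auto
      then show False
        using nE[OF v] b by auto
    qed
    then show "force M w e (embed_fm (Forall x A))"
      by simp
  qed
next
  case (Exists x A)
  then show ?case
    using Exists.IH[of "e(x := _)"] by (auto simp: image_subset_iff)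
qed auto

section \<open>Changing the frame\<close>

text \<open>Serves both to delete nodes and to flatten the order. The structures at the nodes are
  kept, so truth is unaffected and only forcing can change.\<close>

definition reframe :: "('f, 'p, 'w, 'd) kripke \<Rightarrow> 'w set \<Rightarrow> ('w \<times> 'w) set \<Rightarrow> ('f, 'p, 'w, 'd) kripke"
  where "reframe M S R = M\<lparr>Nodes := S, Leq := R\<rparr>"

lemma reframe_simps [simp]:
  "Nodes (reframe M S R) = S" "Leq (reframe M S R) = R" "Dom (reframe M S R) = Dom M"
  "Fint (reframe M S R) = Fint M" "Forced (reframe M S R) = Forced M"
  "reframe (reframe M S R) S' R' = reframe M S' R'"
  "reframe M (Nodes M) (Leq M) = M"
  by (simp_all add: reframe_def)

lemma val_reframe [simp]: "val (reframe M S R) w e = val M w e"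
proof
  show "val (reframe M S R) w e t = val M w e t" for t
  proof (induction t)
    case (App f ts)
    then have "map (val (reframe M S R) w e) ts = map (val M w e) ts"
      by auto
    then show ?case by (cases f) (simp_all del: map_eq_conv)
  qed simp
qed

lemma holds_reframe [simp]: "holds (reframe M S R) w e A = holds M w e A"
  by (induction A arbitrary: e) auto

text \<open>The monotonicity conditions concern pairs of \<open>R\<close> and are inherited from the
  larger order \<open>Leq M\<close>.\<close>

lemma kripke_model_reframe:
  assumes "kripke_model L M" "S \<noteq> {}" "S \<subseteq> Nodes M" "R \<subseteq> Leq M" "partial_order_on S R"
  shows "kripke_model L (reframe M S R)"
proof (rule kripke_modelI)
  fix w f ds
  assume "w \<in> Nodes (reframe M S R)" "(f, length ds) \<in> Funs L" "set ds \<subseteq> Dom (reframe M S R) w"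
  then show "Fint (reframe M S R) w f ds \<in> Dom (reframe M S R) w"
    using kripke_model_Fint[OF assms(1)] assms(3) by auto
next
  fix w v f ds
  assume "(w, v) \<in> Leq (reframe M S R)" "(f, length ds) \<in> Funs L" "set ds \<subseteq> Dom (reframe M S R) w"
  then show "Fint (reframe M S R) v f ds = Fint (reframe M S R) w f ds"
    using kripke_model_Fint_mono[OF assms(1)] assms(4) by auto
next
  fix w v p ds
  assume "(w, v) \<in> Leq (reframe M S R)" "(p, length ds) \<in> Preds L" "set ds \<subseteq> Dom (reframe M S R) w"
    "Forced (reframe M S R) w p ds"
  then show "Forced (reframe M S R) v p ds"
    using kripke_model_Forced_mono[OF assms(1)] assms(4) by auto
next
  show "Dom (reframe M S R) w \<subseteq> Dom (reframe M S R) v" if "(w, v) \<in> Leq (reframe M S R)" for w v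
    using that kripke_model_Dom_mono[OF assms(1), of w v] assms(4) by auto
qed (use assms kripke_model_Dom_nonempty[OF assms(1)] in auto)

section \<open>Deleting the nodes that force a sentence\<close>

definition unforced :: "('f, 'p, 'w, 'd) kripke \<Rightarrow> ('f, 'p) fm \<Rightarrow> 'w set" where
  "unforced M \<rho> = {w \<in> Nodes M. \<not> (\<exists>e. force M w e (embed_fm \<rho>))}"

text \<open>This construction is known as pruning.\<close>

definition cutoff :: "('f, 'p, 'w, 'd) kripke \<Rightarrow> ('f, 'p) fm \<Rightarrow> ('f, 'p, 'w, 'd) kripke" where
  "cutoff M \<rho> = reframe M (unforced M \<rho>) (Leq M \<inter> unforced M \<rho> \<times> unforced M \<rho>)"

lemma cutoff_simps [simp]:
  "Nodes (cutoff M \<rho>) = unforced M \<rho>" "Leq (cutoff M \<rho>) = Leq M \<inter> unforced M \<rho> \<times> unforced M \<rho>"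
  "Dom (cutoff M \<rho>) = Dom M" "Forced (cutoff M \<rho>) = Forced M" "val (cutoff M \<rho>) w e = val M w e"
  "holds (cutoff M \<rho>) w e A = holds M w e A"
  by (simp_all add: cutoff_def)

lemma unforced_iff:
  assumes "sentence L \<rho>" "w \<in> Nodes M"
  shows "w \<in> unforced M \<rho> \<longleftrightarrow> \<not> force M w e (embed_fm \<rho>)"
  using assms force_closed[of "embed_fm \<rho>" M w] by (auto simp: unforced_def sentence_def)

lemma partial_order_on_restrict:
  "partial_order_on A r \<Longrightarrow> S \<subseteq> A \<Longrightarrow> partial_order_on S (r \<inter> S \<times> S)"
  unfolding partial_order_on_def preorder_on_def refl_on_def antisym_def trans_def by blast

lemma kripke_model_cutoff:
  assumes "kripke_model L M" "unforced M \<rho> \<noteq> {}"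
  shows "kripke_model L (cutoff M \<rho>)"
  unfolding cutoff_def using assms kripke_model_po[OF assms(1)]
  by (intro kripke_model_reframe partial_order_on_restrict) (auto simp: unforced_def)

text \<open>Start of the iterated deletion: no node forces \<open>Bot\<close>.\<close>

lemma cutoff_Bot: "kripke_model L M \<Longrightarrow> cutoff M Bot = M"
proof -
  assume M: "kripke_model L M"
  have u: "unforced M Bot = Nodes M"
    by (simp add: unforced_def)
  have "Leq M \<inter> Nodes M \<times> Nodes M = Leq M"
    using kripke_model_Leq_Nodes[OF M] by auto
  then show ?thesis
    by (simp add: cutoff_def u)
qed

text \<open>Nodes forcing \<rho> are closed upwards and force every translated formula. A surviving
  node does not force \<rho>, so the added disjuncts are idle there, and its deleted successors
  satisfy the clauses for \<open>Imp\<close> and \<open>Forall\<close> trivially; only surviving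
  successors matter.\<close>

lemma force_friedman:
  assumes M: "kripke_model L M" and \<rho>: "sentence L \<rho>"
  shows "w \<in> Nodes M \<Longrightarrow>
    force M w e (friedman A (embed_fm \<rho>)) \<longleftrightarrow> w \<notin> unforced M \<rho> \<or> force (cutoff M \<rho>) w e A"
proof (induction A arbitrary: w e)
  case (Imp A B)
  have up: "v \<notin> unforced M \<rho>" if "(w, v) \<in> Leq M" "w \<notin> unforced M \<rho>" for v
    using that sentence_force_mono[OF M \<rho>] Imp.prems unfolding unforced_def by blast
  show ?case
    using up Imp.IH kripke_model_Leq_Nodes(2)[OF M] by (auto 4 4)
next
  case (Forall x A)
  have up: "v \<notin> unforced M \<rho>" if "(w, v) \<in> Leq M" "w \<notin> unforced M \<rho>" for v
    using that sentence_force_mono[OF M \<rho>] Forall.prems unfolding unforced_def by blast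
  show ?case
    using up Forall.IH kripke_model_Leq_Nodes(2)[OF M] by (auto 4 4)
next
  case (Exists x A)
  \<comment> \<open>At a deleted node every individual is a witness, and the domain has one.\<close>
  then show ?case
    using kripke_model_Dom_nonempty[OF M Exists.prems] by auto
next
  case Bot
  then show ?case
    using unforced_iff[OF \<rho>, of w M e] by simp
next
  case (Atom p ts)
  then show ?case
    using unforced_iff[OF \<rho>, of w M e] by auto
qed auto

text \<open>By \<open>force_friedman\<close> a node escapes the translated formula iff it survives
  the cut by \<rho> and then, in the smaller model, the cut by \<open>A\<close>. The exponent is
  therefore the sentence cut by first.\<close>

lemma cutoff_friedman:
  assumes M: "kripke_model L M" and \<rho>: "sentence L \<rho>"
  shows "cutoff M (friedman A \<rho>) = cutoff (cutoff M \<rho>) A"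
proof -
  have u: "unforced M (friedman A \<rho>) = unforced (cutoff M \<rho>) A"
    using force_friedman[OF M \<rho>, of _ _ "embed_fm A"]
    by (auto simp: unforced_def[of _ "friedman _ _"] unforced_def[of "cutoff _ _"] embed_fm_friedman)
       (auto simp: unforced_def)
  have "unforced (cutoff M \<rho>) A \<subseteq> unforced M \<rho>"
    by (auto simp: unforced_def[of "cutoff _ _"])
  then have "Leq M \<inter> unforced M \<rho> \<times> unforced M \<rho> \<inter> unforced (cutoff M \<rho>) A \<times> unforced (cutoff M \<rho>) A
      = Leq M \<inter> unforced (cutoff M \<rho>) A \<times> unforced (cutoff M \<rho>) A"
    by auto
  then show ?thesis
    unfolding cutoff_def[of _ "friedman _ _"] u unfolding cutoff_def[of "cutoff _ _"]
    by (simp add: cutoff_def)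
qed

section \<open>Chains\<close>

text \<open>Here \<open>n\<close> counts nodes, whereas \<open>has_depth\<close> counts steps; hence
  the shifts by one. No chain has to attain the bound, so smaller models inherit it.\<close>

definition chains_bounded :: "('f, 'p, 'w, 'd) kripke \<Rightarrow> nat \<Rightarrow> bool" where
  "chains_bounded M n \<longleftrightarrow> (\<forall>C\<in>Chains (Leq M). finite C \<and> card C \<le> n)"

lemma Chains_insert_top:
  assumes "C \<in> Chains r" "(v, v) \<in> r" "\<And>a. a \<in> C \<Longrightarrow> (a, v) \<in> r"
  shows "insert v C \<in> Chains r"
  using assms unfolding Chains_def by auto

lemma finite_chain_top:
  assumes "kripke_model L M" "finite C" "C \<noteq> {}" "C \<in> Chains (Leq M)"
  shows "\<exists>t\<in>C. \<forall>a\<in>C. (a, t) \<in> Leq M"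
  using assms(2-4)
proof (induction C rule: finite_ne_induct)
  case (singleton x)
  then show ?case by (auto simp: Chains_def)
next
  case (insert x F)
  then obtain t where t: "t \<in> F" "\<forall>a\<in>F. (a, t) \<in> Leq M"
    by (auto simp: Chains_def)
  have "(x, x) \<in> Leq M" "(x, t) \<in> Leq M \<or> (t, x) \<in> Leq M"
    using insert.prems t(1) by (auto simp: Chains_def)
  then show ?case
    using t kripke_model_trans[OF assms(1)] by blast
qed

text \<open>A proper successor of the top of \<open>C\<close> lies above all of \<open>C\<close>
  and, by antisymmetry, outside it. The predicate \<open>P\<close> keeps the extension inside a
  prescribed set.\<close>

lemma chain_extend:
  assumes "kripke_model L M" "finite C" "C \<noteq> {}" "C \<in> Chains (Leq M)"
    and "\<And>t. t \<in> C \<Longrightarrow> \<exists>v. (t, v) \<in> Leq M \<and> v \<noteq> t \<and> P v"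
  shows "\<exists>v. P v \<and> v \<notin> C \<and> insert v C \<in> Chains (Leq M)"
proof -
  obtain t where t: "t \<in> C" "\<forall>a\<in>C. (a, t) \<in> Leq M"
    using finite_chain_top[OF assms(1-4)] by auto
  obtain v where v: "(t, v) \<in> Leq M" "v \<noteq> t" "P v"
    using assms(5)[OF t(1)] by blast
  have "v \<notin> C"
    using v t kripke_model_antisym[OF assms(1)] by blast
  moreover have "insert v C \<in> Chains (Leq M)"
    using assms(4) kripke_model_refl[OF assms(1) kripke_model_Leq_Nodes(2)[OF assms(1) v(1)]]
      kripke_model_trans[OF assms(1) _ v(1)] t by (intro Chains_insert_top) auto
  ultimately show ?thesis using v by blast
qed

text \<open>If every node of \<open>Q\<close> had a proper successor in \<open>Q\<close>, chains of
  every finite size could be built upwards inside \<open>Q\<close>.\<close>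

lemma chains_bounded_maximal:
  assumes "kripke_model L M" "chains_bounded M n" "Q \<subseteq> Nodes M" "Q \<noteq> {}"
  shows "\<exists>m\<in>Q. \<forall>v. (m, v) \<in> Leq M \<longrightarrow> v \<noteq> m \<longrightarrow> v \<notin> Q"
proof (rule ccontr)
  assume "\<not> ?thesis"
  then have ext: "\<exists>v. (t, v) \<in> Leq M \<and> v \<noteq> t \<and> v \<in> Q" if "t \<in> Q" for t
    using that by blast
  have "\<exists>C. C \<subseteq> Q \<and> C \<in> Chains (Leq M) \<and> finite C \<and> card C = Suc k" for k
  proof (induction k)
    case 0
    obtain q where "q \<in> Q" using assms(4) by auto
    then have "{q} \<in> Chains (Leq M)"
      using kripke_model_refl[OF assms(1)] assms(3) by (auto simp: Chains_def)
    then show ?case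
      using \<open>q \<in> Q\<close> by (intro exI[of _ "{q}"]) auto
  next
    case (Suc k)
    then obtain C where C: "C \<subseteq> Q" "C \<in> Chains (Leq M)" "finite C" "card C = Suc k"
      by auto
    then have "C \<noteq> {}" by auto
    then obtain v where "v \<in> Q" "v \<notin> C" "insert v C \<in> Chains (Leq M)"
      using chain_extend[OF assms(1) C(3) _ C(2), of "\<lambda>v. v \<in> Q"] ext C(1) by blast
    then show ?case
      using C by (intro exI[of _ "insert v C"]) auto
  qed
  from this[of n] show False
    using assms(2) unfolding chains_bounded_def by fastforce
qed

text \<open>A largest cardinality of chains is attained. It is not 0, because singletons of nodes
  are chains, so it has the form \<open>Suc n\<close> required for depth \<open>n\<close>.\<close>

lemma has_depth_of_chains_bounded:
  assumes "kripke_model L M" "chains_bounded M (Suc m)"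
  shows "\<exists>n\<le>m. has_depth M n"
proof -
  obtain w where "w \<in> Nodes M"
    using assms(1) by (auto simp: kripke_model_def)
  then have w: "{w} \<in> Chains (Leq M)"
    using kripke_model_refl[OF assms(1)] by (auto simp: Chains_def)
  have "\<forall>C. C \<in> Chains (Leq M) \<longrightarrow> card C < Suc (Suc m)"
    using assms(2) by (auto simp: chains_bounded_def less_Suc_eq_le)
  then obtain C where C: "C \<in> Chains (Leq M)" "\<forall>C'. C' \<in> Chains (Leq M) \<longrightarrow> card C' \<le> card C"
    using ex_has_greatest_nat[of "\<lambda>C. C \<in> Chains (Leq M)" "{w}" card "Suc (Suc m)"] w by auto
  have "card C \<noteq> 0"
    using C(2) w by fastforce
  then obtain n where n: "card C = Suc n"
    using not0_implies_Suc by blast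
  have "finite C" "n \<le> m"
    using assms(2) C(1) n by (auto simp: chains_bounded_def)
  moreover have "has_depth M n"
    unfolding has_depth_def using C n assms(2) by (auto simp: chains_bounded_def)
  ultimately show ?thesis by blast
qed

lemma has_depth_0_end_node:
  assumes "kripke_model L M" "has_depth M 0" "w \<in> Nodes M"
  shows "(w, v) \<in> Leq M \<longleftrightarrow> v = w"
proof
  assume v: "(w, v) \<in> Leq M"
  then have "{w, v} \<in> Chains (Leq M)"
    using kripke_model_refl[OF assms(1)] kripke_model_Leq_Nodes[OF assms(1) v]
    by (auto simp: Chains_def)
  then have "card {w, v} \<le> Suc 0"
    using assms(2) by (auto simp: has_depth_def)
  then show "v = w"
    by (cases "v = w") auto
qed (simp add: kripke_model_refl[OF assms(1,3)])

text \<open>A maximal node of \<open>M\<close> is classical, hence forces \<open>B\<close>: every chain of \<open>cutoff M B\<close> extends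
  beyond its top in \<open>M\<close>.\<close>

lemma chains_bounded_cutoff:
  assumes "kripke_model L M" "B \<in> PEM L" "chains_bounded M (Suc n)"
  shows "chains_bounded (cutoff M B) n"
  unfolding chains_bounded_def
proof
  fix C
  assume C: "C \<in> Chains (Leq (cutoff M B))"
  then have CM: "C \<in> Chains (Leq M)" and Cu: "C \<subseteq> unforced M B"
    by (auto simp: Chains_def)
  have fin: "finite C"
    using CM assms(3) by (auto simp: chains_bounded_def)
  show "finite C \<and> card C \<le> n"
  proof (cases "C = {}")
    case False
    have "\<exists>v. (t, v) \<in> Leq M \<and> v \<noteq> t \<and> True" if "t \<in> C" for t
    proof (rule ccontr)
      assume "\<not> ?thesis"
      moreover have t: "t \<in> Nodes M" "\<not> (\<exists>e. force M t e (embed_fm B))"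
        using that Cu by (auto simp: unforced_def)
      ultimately show False
        using end_node_forces_PEM[OF assms(1) t(1) assms(2)] kripke_model_refl[OF assms(1) t(1)]
        by blast
    qed
    from chain_extend[OF assms(1) fin False CM this] obtain v
      where "v \<notin> C" "insert v C \<in> Chains (Leq M)" by blast
    then show ?thesis
      using assms(3) fin by (fastforce simp: chains_bounded_def)
  qed simp
qed

section \<open>Downward Loewenheim-Skolem\<close>

text \<open>Formulas serve as codes for the elements of a Skolem hull: a code denotes a node together with
  an assignment, and the individual coded is the value of the assignment at 0. \<open>And\<close> is cons on
  assignments, \<open>Or\<close> joins a node and an assignment, and \<open>Imp A C\<close> is the Skolem function of \<open>A\<close>
  applied to \<open>C\<close>, where \<open>Atom p [t]\<close> stands for the term \<open>t\<close>.\<close>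

fun skolem_fun ::
  "('f, 'p, 'w, 'd) kripke \<Rightarrow> ('f, 'p) fm \<Rightarrow> 'w \<times> (nat \<Rightarrow> 'd) \<Rightarrow> 'w \<times> (nat \<Rightarrow> 'd)" where
  "skolem_fun M (Atom p [t]) (w, e) = (w, \<lambda>_. val M w e (map_trm Inl t))"
| "skolem_fun M (Imp A B) (w, e) =
     (SOME v. (w, v) \<in> Leq M \<and> force M v e (embed_fm A) \<and> \<not> force M v e (embed_fm B), e)"
| "skolem_fun M (Forall x A) (w, e) =
     (SOME (v, b). (w, v) \<in> Leq M \<and> b 0 \<in> Dom M v \<and> \<not> force M v (e(x := b 0)) (embed_fm A))"
| "skolem_fun M (Exists x A) (w, e) =
     (w, \<lambda>_. SOME b. b \<in> Dom M w \<and> force M w (e(x := b)) (embed_fm A))"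
| "skolem_fun M _ s = s"

primrec decode ::
  "('f, 'p, 'w, 'd) kripke \<Rightarrow> 'w \<Rightarrow> (nat \<Rightarrow> 'd) \<Rightarrow> ('f, 'p) fm \<Rightarrow> 'w \<times> (nat \<Rightarrow> 'd)" where
  "decode M w e Bot = (w, e)"
| "decode M w e (Atom p ts) = (w, e)"
| "decode M w e (And C E) =
     (fst (decode M w e E), case_nat (snd (decode M w e C) 0) (snd (decode M w e E)))"
| "decode M w e (Or C E) = (fst (decode M w e C), snd (decode M w e E))"
| "decode M w e (Imp A C) = skolem_fun M A (decode M w e C)"
| "decode M w e (Forall x A) = (w, e)"
| "decode M w e (Exists x A) = (w, e)"

section \<open>The hull generated by a node and an assignment\<close>

locale skolem_hull =
  fixes L :: "('f, 'p) lang"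
    and M :: "('f, 'p, 'w, 'd) kripke"
    and w0 :: 'w
    and e0 :: "nat \<Rightarrow> 'd"
  assumes M: "kripke_model L M"
    and w0: "w0 \<in> Nodes M"
    and e0: "range e0 \<subseteq> Dom M w0"
begin

definition node :: "('f, 'p) fm \<Rightarrow> 'w" where
  "node c = fst (decode M w0 e0 c)"

definition elem :: "('f, 'p) fm \<Rightarrow> 'd" where
  "elem c = snd (decode M w0 e0 c) 0"

text \<open>Iterated \<open>And\<close> prepends the codes \<open>e 0\<close>, \<open>e 1\<close>
  and so on to \<open>n\<close> without changing its node. Only finitely many values can be
  prescribed, which suffices for one formula or one argument list.\<close>

lemma assignment_code:
  "\<exists>c. node c = node n \<and> (\<forall>x<k. snd (decode M w0 e0 c) x = elem (e x))"
proof (induction k arbitrary: e)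
  case (Suc k)
  obtain c where c: "node c = node n" "\<forall>x<k. snd (decode M w0 e0 c) x = elem (e (Suc x))"
    using Suc[of "\<lambda>x. e (Suc x)"] by blast
  show ?case
  proof (intro exI[of _ "And (e 0) c"] conjI allI impI)
    show "node (And (e 0) c) = node n"
      using c(1) by (simp add: node_def)
    show "snd (decode M w0 e0 (And (e 0) c)) x = elem (e x)" if "x < Suc k" for x
      using that c(2) by (cases x) (auto simp: elem_def)
  qed
qed auto

lemma formula_assignment_code:
  obtains c where "node c = node n"
    and "\<And>x. x \<in> fv A \<Longrightarrow> snd (decode M w0 e0 c) x = elem (e x)"
proof -
  obtain k where "\<forall>x\<in>fv A. x < k"
    using finite_fv[of A] finite_nat_set_iff_bounded by blast
  moreover obtain c where "node c = node n" "\<forall>x<k. snd (decode M w0 e0 c) x = elem (e x)"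
    using assignment_code[of n k e] by blast
  ultimately show ?thesis
    using that by blast
qed

text \<open>The argument list is coded as an assignment, under which the term applying
  \<open>f\<close> to the first variables is evaluated.\<close>

lemma elem_Fint: "Fint M (node n) f (map elem cs) \<in> range elem"
proof -
  obtain c where c: "node c = node n"
    "\<forall>x<length cs. snd (decode M w0 e0 c) x = elem (cs ! x)"
    using assignment_code[of n "length cs" "\<lambda>x. cs ! x"] by blast
  \<comment> \<open>The atom only wraps the term, so its predicate symbol is arbitrary.\<close>
  let ?c = "Imp (Atom undefined [App f (map Var [0..<length cs])]) c"
  have "map (snd (decode M w0 e0 c)) [0..<length cs] = map elem cs"
    using c(2) by (intro nth_equalityI) auto
  then have "elem ?c = Fint M (node n) f (map elem cs)"
    using c(1) by (cases "decode M w0 e0 c") (simp add: elem_def node_def o_def)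
  then show ?thesis
    by (metis rangeI)
qed

text \<open>Forcing depends only on the free variables, whose values are fixed by some code
  \<open>c\<close> at the same node. The Skolem function of the formula applied to \<open>c\<close>
  codes a witness. The next two lemmas use the same device for failures of \<open>Imp\<close> and
  \<open>Forall\<close>.\<close>

lemma Exists_witness:
  assumes "force M (node n) (elem \<circ> e) (embed_fm (Exists x A))"
  shows "\<exists>b. elem b \<in> Dom M (node n) \<and> force M (node n) (elem \<circ> e(x := b)) (embed_fm A)"
proof -
  obtain c where c: "node c = node n"
    "\<And>y. y \<in> fv (Exists x A) \<Longrightarrow> snd (decode M w0 e0 c) y = elem (e y)"
    using formula_assignment_code[of n "Exists x A" e] by blast
  let ?e = "snd (decode M w0 e0 c)"
  have eq: "force M (node n) (?e(x := b)) (embed_fm A)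
      = force M (node n) ((elem \<circ> e)(x := b)) (embed_fm A)" for b
    by (rule force_cong) (use c(2) in auto)
  let ?b = "SOME b. b \<in> Dom M (node n) \<and> force M (node n) (?e(x := b)) (embed_fm A)"
  have "\<exists>b. b \<in> Dom M (node n) \<and> force M (node n) (?e(x := b)) (embed_fm A)"
    using assms unfolding eq by auto
  then have b: "?b \<in> Dom M (node n) \<and> force M (node n) (?e(x := ?b)) (embed_fm A)"
    by (rule someI_ex)
  have "elem (Imp (Exists x A) c) = ?b"
    using c(1) by (cases "decode M w0 e0 c") (simp add: elem_def node_def)
  then show ?thesis
    using b unfolding eq by (intro exI[of _ "Imp (Exists x A) c"]) (simp add: fun_upd_comp)
qed

lemma Imp_witness:
  assumes "\<not> force M (node n) (elem \<circ> e) (embed_fm (Imp A B))"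
  shows "\<exists>m. (node n, node m) \<in> Leq M \<and> force M (node m) (elem \<circ> e) (embed_fm A) \<and>
    \<not> force M (node m) (elem \<circ> e) (embed_fm B)"
proof -
  obtain c where c: "node c = node n"
    "\<And>y. y \<in> fv (Imp A B) \<Longrightarrow> snd (decode M w0 e0 c) y = elem (e y)"
    using formula_assignment_code[of n "Imp A B" e] by blast
  let ?e = "snd (decode M w0 e0 c)"
  have eq: "force M v ?e (embed_fm A) = force M v (elem \<circ> e) (embed_fm A)"
    "force M v ?e (embed_fm B) = force M v (elem \<circ> e) (embed_fm B)" for v
    by (rule force_cong; use c(2) in auto)+
  let ?v = "SOME v. (node n, v) \<in> Leq M \<and> force M v ?e (embed_fm A) \<and> \<not> force M v ?e (embed_fm B)"
  have "\<exists>v. (node n, v) \<in> Leq M \<and> force M v ?e (embed_fm A) \<and> \<not> force M v ?e (embed_fm B)"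
    using assms unfolding eq by auto
  then have v: "(node n, ?v) \<in> Leq M \<and> force M ?v ?e (embed_fm A) \<and> \<not> force M ?v ?e (embed_fm B)"
    by (rule someI_ex)
  have "node (Imp (Imp A B) c) = ?v"
    using c(1) by (cases "decode M w0 e0 c") (simp add: node_def)
  then show ?thesis
    using v unfolding eq by (intro exI[of _ "Imp (Imp A B) c"]) simp
qed

lemma Forall_witness:
  assumes "\<not> force M (node n) (elem \<circ> e) (embed_fm (Forall x A))"
  shows "\<exists>m b. (node n, node m) \<in> Leq M \<and> elem b \<in> Dom M (node m) \<and>
    \<not> force M (node m) (elem \<circ> e(x := b)) (embed_fm A)"
proof -
  obtain c where c: "node c = node n"
    "\<And>y. y \<in> fv (Forall x A) \<Longrightarrow> snd (decode M w0 e0 c) y = elem (e y)"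
    using formula_assignment_code[of n "Forall x A" e] by blast
  let ?e = "snd (decode M w0 e0 c)"
  have eq: "force M v (?e(x := b)) (embed_fm A)
      = force M v ((elem \<circ> e)(x := b)) (embed_fm A)" for v b
    by (rule force_cong) (use c(2) in auto)
  \<comment> \<open>A counterexample consists of a node and an individual. As
    \<open>skolem_fun\<close> returns assignments, the individual is the value of \<open>b\<close>
    at 0, which is also where \<open>elem\<close> reads it.\<close>
  let ?P = "\<lambda>(v, b). (node n, v) \<in> Leq M \<and> b (0::nat) \<in> Dom M v \<and>
    \<not> force M v (?e(x := b 0)) (embed_fm A)"
  obtain v b where "(node n, v) \<in> Leq M" "b \<in> Dom M v" "\<not> force M v (?e(x := b)) (embed_fm A)"
    using assms unfolding eq by auto
  then have "?P (v, \<lambda>_. b)"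
    by simp
  then have P: "?P (Eps ?P)"
    by (rule someI)
  have dec: "decode M w0 e0 (Imp (Forall x A) c) = Eps ?P"
    using c(1) by (cases "decode M w0 e0 c") (simp add: node_def)
  have "?P (decode M w0 e0 (Imp (Forall x A) c))"
    unfolding dec by (rule P)
  then have "(node n, node (Imp (Forall x A) c)) \<in> Leq M \<and>
      elem (Imp (Forall x A) c) \<in> Dom M (node (Imp (Forall x A) c)) \<and>
      \<not> force M (node (Imp (Forall x A) c)) (?e(x := elem (Imp (Forall x A) c))) (embed_fm A)"
    by (simp only: node_def elem_def case_prod_beta simp_thms)
  then show ?thesis
    unfolding eq fun_upd_comp by blast
qed

text \<open>The sentence \<open>Exists 0 (Neg Bot)\<close> is forced at every node, so it has a
  coded witness.\<close>

lemma Dom_node_nonempty: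
  assumes "node n \<in> Nodes M"
  shows "\<exists>c. elem c \<in> Dom M (node n)"
proof -
  have "force M (node n) (elem \<circ> e) (embed_fm (Exists 0 (Neg Bot)))" for e
    using kripke_model_Dom_nonempty[OF M assms] by auto
  from Exists_witness[OF this] show ?thesis by blast
qed

text \<open>One code is kept for each node: \<open>node\<close> becomes injective, which makes the
  order antisymmetric and lets chains of the hull map injectively to chains of
  \<open>M\<close>.\<close>

definition hull_nodes :: "('f, 'p) fm set" where
  "hull_nodes = inv node ` (range node \<inter> Nodes M)"

text \<open>Several codes of one individual may coexist; this is harmless, as an equality symbol is
  interpreted like any other predicate. \<open>inv elem\<close> selects a code by the value alone,
  so operations agree along the order.\<close>

definition hull :: "('f, 'p) small_kripke" where
  "hull = \<lparr>Nodes = hull_nodes,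
     Leq = {(a, b). a \<in> hull_nodes \<and> b \<in> hull_nodes \<and> (node a, node b) \<in> Leq M},
     Dom = \<lambda>n. {c. elem c \<in> Dom M (node n)},
     Fint = \<lambda>n f cs. inv elem (Fint M (node n) f (map elem cs)),
     Forced = \<lambda>n p cs. Forced M (node n) p (map elem cs)\<rparr>"

lemma hull_simps [simp]:
  "Nodes hull = hull_nodes"
  "(a, b) \<in> Leq hull \<longleftrightarrow> a \<in> hull_nodes \<and> b \<in> hull_nodes \<and> (node a, node b) \<in> Leq M"
  "c \<in> Dom hull n \<longleftrightarrow> elem c \<in> Dom M (node n)"
  "elem (Fint hull n f cs) = Fint M (node n) f (map elem cs)"
  "Forced hull n p cs = Forced M (node n) p (map elem cs)"
  using f_inv_into_f[OF elem_Fint] by (simp_all add: hull_def)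

lemma inj_on_node: "inj_on node hull_nodes"
  by (rule inj_onI) (auto simp: hull_nodes_def f_inv_into_f)

lemma node_hull_nodes: "n \<in> hull_nodes \<Longrightarrow> node n \<in> Nodes M"
  by (auto simp: hull_nodes_def f_inv_into_f)

lemma ex_hull_node: "node m \<in> Nodes M \<Longrightarrow> \<exists>n\<in>hull_nodes. node n = node m"
  by (intro bexI[of _ "inv node (node m)"]) (auto simp: hull_nodes_def f_inv_into_f)

lemma node_Bot: "node Bot = w0"
  by (simp add: node_def)

lemma kripke_model_hull: "kripke_model L hull"
proof (rule kripke_modelI)
  show "Nodes hull \<noteq> {}"
    using ex_hull_node[of Bot] w0 node_Bot by auto
  have "antisym (Leq hull)"
    by (rule antisymI) (auto intro: inj_onD[OF inj_on_node] kripke_model_antisym[OF M])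
  moreover have "trans (Leq hull)"
    by (rule transI) (auto intro: kripke_model_trans[OF M])
  moreover have "(n, n) \<in> Leq hull" if "n \<in> hull_nodes" for n
    using that kripke_model_refl[OF M node_hull_nodes] by auto
  ultimately show "partial_order_on (Nodes hull) (Leq hull)"
    unfolding partial_order_on_def preorder_on_def refl_on_def by auto
next
  show "Dom hull n \<noteq> {}" if "n \<in> Nodes hull" for n
    using Dom_node_nonempty[of n] node_hull_nodes that hull_simps(3) by (metis empty_iff hull_simps(1))
  show "Dom hull n \<subseteq> Dom hull m" if "(n, m) \<in> Leq hull" for n m
    using that kripke_model_Dom_mono[OF M, of "node n" "node m"] by auto
  show "Fint hull n f cs \<in> Dom hull n"
    if "n \<in> Nodes hull" "(f, length cs) \<in> Funs L" "set cs \<subseteq> Dom hull n" for n f cs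
  proof -
    have "set (map elem cs) \<subseteq> Dom M (node n)"
      using that(3) hull_simps(3) by fastforce
    then show ?thesis
      using that(1,2) node_hull_nodes by (auto intro!: kripke_model_Fint[OF M])
  qed
  show "Fint hull m f cs = Fint hull n f cs"
    if "(n, m) \<in> Leq hull" "(f, length cs) \<in> Funs L" "set cs \<subseteq> Dom hull n" for n m f cs
  proof -
    have "Fint M (node m) f (map elem cs) = Fint M (node n) f (map elem cs)"
      using that by (intro kripke_model_Fint_mono[OF M]) auto
    then show ?thesis by (simp add: hull_def)
  qed
  show "Forced hull m p cs"
    if "(n, m) \<in> Leq hull" "(p, length cs) \<in> Preds L" "set cs \<subseteq> Dom hull n" "Forced hull n p cs"
    for n m p cs
  proof -
    have "set (map elem cs) \<subseteq> Dom M (node n)"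
      using that(3) hull_simps(3) by fastforce
    then show ?thesis
      using that kripke_model_Forced_mono[OF M, of "node n" "node m" p "map elem cs"] by simp
  qed
qed

lemma elem_val_hull:
  "elem (val hull n e (map_trm Inl t)) = val M (node n) (elem \<circ> e) (map_trm Inl t)"
proof (induction t)
  case (App f ts)
  then have "map (elem \<circ> (val hull n e \<circ> map_trm Inl)) ts
      = map (val M (node n) (elem \<circ> e) \<circ> map_trm Inl) ts"
    by (auto simp: o_def)
  then show ?case by (simp add: o_def del: map_eq_conv)
qed simp

text \<open>A Tarski-Vaught argument: the node or individual that refutes an implication or
  universal formula, or verifies an existential one, can be found among the coded ones.
  \<open>ex_hull_node\<close> then passes to the representative of the node.\<close>

lemma force_hull:
  "n \<in> hull_nodes \<Longrightarrow> force hull n e (embed_fm A) = force M (node n) (elem \<circ> e) (embed_fm A)"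
proof (induction A arbitrary: n e)
  case (Atom p ts)
  have "map (elem \<circ> (val hull n e \<circ> map_trm Inl)) ts
      = map (val M (node n) (elem \<circ> e) \<circ> map_trm Inl) ts"
    by (simp add: elem_val_hull)
  then show ?case by (simp add: o_def del: map_eq_conv)
next
  case (Imp A B)
  have "\<exists>m\<in>hull_nodes. (node n, node m) \<in> Leq M \<and> force M (node m) (elem \<circ> e) (embed_fm A) \<and>
    \<not> force M (node m) (elem \<circ> e) (embed_fm B)"
    if nf: "\<not> force M (node n) (elem \<circ> e) (embed_fm (Imp A B))"
  proof -
    obtain m where m: "(node n, node m) \<in> Leq M" "force M (node m) (elem \<circ> e) (embed_fm A)"
      "\<not> force M (node m) (elem \<circ> e) (embed_fm B)"
      using Imp_witness[OF nf] by blast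
    obtain m' where "m' \<in> hull_nodes" "node m' = node m"
      using ex_hull_node[OF kripke_model_Leq_Nodes(2)[OF M m(1)]] by blast
    then show ?thesis using m by (intro bexI[of _ m']) simp_all
  qed
  then have "force M (node n) (elem \<circ> e) (embed_fm (Imp A B)) \<longleftrightarrow>
      (\<forall>m\<in>hull_nodes. (node n, node m) \<in> Leq M \<longrightarrow> force M (node m) (elem \<circ> e) (embed_fm A) \<longrightarrow>
        force M (node m) (elem \<circ> e) (embed_fm B))"
    unfolding embed_fm_simps force.simps by blast
  then show ?case
    using Imp.IH Imp.prems by (auto simp: o_def)
next
  case (Forall x A)
  have "\<exists>m\<in>hull_nodes. \<exists>b. (node n, node m) \<in> Leq M \<and> elem b \<in> Dom M (node m) \<and>
    \<not> force M (node m) (elem \<circ> e(x := b)) (embed_fm A)"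
    if nf: "\<not> force M (node n) (elem \<circ> e) (embed_fm (Forall x A))"
  proof -
    obtain m b where m: "(node n, node m) \<in> Leq M" "elem b \<in> Dom M (node m)"
      "\<not> force M (node m) (elem \<circ> e(x := b)) (embed_fm A)"
      using Forall_witness[OF nf] by blast
    obtain m' where "m' \<in> hull_nodes" "node m' = node m"
      using ex_hull_node[OF kripke_model_Leq_Nodes(2)[OF M m(1)]] by blast
    then show ?thesis using m by (intro bexI[of _ m'] exI[of _ b]) simp_all
  qed
  moreover have "force M (node m) (elem \<circ> e(x := b)) (embed_fm A)"
    if "force M (node n) (elem \<circ> e) (embed_fm (Forall x A))" "(node n, node m) \<in> Leq M"
      "elem b \<in> Dom M (node m)" for m b
    unfolding fun_upd_comp using that by simp
  ultimately have "force M (node n) (elem \<circ> e) (embed_fm (Forall x A)) \<longleftrightarrow>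
      (\<forall>m\<in>hull_nodes. (node n, node m) \<in> Leq M \<longrightarrow> (\<forall>b. elem b \<in> Dom M (node m) \<longrightarrow>
        force M (node m) (elem \<circ> e(x := b)) (embed_fm A)))"
    by blast
  moreover have "force hull n e (embed_fm (Forall x A)) \<longleftrightarrow>
      (\<forall>m\<in>hull_nodes. (node n, node m) \<in> Leq M \<longrightarrow> (\<forall>b. elem b \<in> Dom M (node m) \<longrightarrow>
        force hull m (e(x := b)) (embed_fm A)))"
    using Forall.prems unfolding embed_fm_simps force.simps Ball_def hull_simps by blast
  moreover have "force hull m (e(x := b)) (embed_fm A)
      = force M (node m) (elem \<circ> e(x := b)) (embed_fm A)" if "m \<in> hull_nodes" for m b
    by (rule Forall.IH[OF that])
  ultimately show ?case
    by blast
next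
  case (Exists x A)
  have "force M (node n) (elem \<circ> e) (embed_fm (Exists x A)) \<longleftrightarrow>
      (\<exists>b. elem b \<in> Dom M (node n) \<and> force M (node n) (elem \<circ> e(x := b)) (embed_fm A))"
    using Exists_witness[of n e x A] by (auto simp: fun_upd_comp)
  moreover have "force hull n (e(x := b)) (embed_fm A)
      = force M (node n) (elem \<circ> e(x := b)) (embed_fm A)" for b
    by (rule Exists.IH[OF Exists.prems])
  ultimately show ?case
    unfolding embed_fm_simps force.simps Bex_def hull_simps by blast
qed auto

lemma chains_bounded_hull:
  assumes "chains_bounded M n"
  shows "chains_bounded hull n"
  unfolding chains_bounded_def
proof
  fix C
  assume C: "C \<in> Chains (Leq hull)"
  then have sub: "C \<subseteq> hull_nodes" and "node ` C \<in> Chains (Leq M)"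
    by (auto simp: Chains_def)
  then have "finite (node ` C)" "card (node ` C) \<le> n"
    using assms by (auto simp: chains_bounded_def)
  moreover have "inj_on node C"
    using inj_on_node sub by (rule inj_on_subset)
  ultimately show "finite C \<and> card C \<le> n"
    by (simp add: finite_image_iff card_image)
qed

lemma refutes_hull:
  assumes "\<not> force M w0 e0 (embed_fm A)"
  shows "refutes hull A"
proof -
  obtain n where n: "n \<in> hull_nodes" "node n = w0"
    using ex_hull_node[of Bot] w0 node_Bot by auto
  \<comment> \<open>\<open>Bot\<close> codes \<open>w0\<close> together with \<open>e0\<close>, and
    evaluating the term \<open>Var x\<close> there gives \<open>e0 x\<close>.\<close>
  let ?e = "\<lambda>x. Imp (Atom undefined [Var x]) Bot"
  have e: "elem (?e x) = e0 x" for x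
    by (simp add: elem_def)
  have "\<not> force hull n ?e (embed_fm A)"
    using assms n e by (simp add: force_hull o_def)
  moreover have "range ?e \<subseteq> Dom hull n"
    using e e0 n by auto
  ultimately show ?thesis
    using n(1) unfolding refutes_def forces_def by auto
qed

end

text \<open>Chains of at most two nodes mean depth at most 1, and the hull carries the refutation to
  a model of the type demanded by \<open>kripke_rank\<close>. Depth 0 is excluded: there all nodes
  are end nodes and force PEM.\<close>

lemma PEM1_if_refuted:
  fixes M :: "('f, 'p, 'w, 'd) kripke"
  assumes "kripke_model L M" "chains_bounded M (Suc (Suc 0))" "w \<in> Nodes M"
    and "B \<in> PEM L" "\<not> force M w e (embed_fm B)"
  shows "B \<in> PEM1 L"
proof -
  obtain d where d: "d \<in> Dom M w"
    using kripke_model_Dom_nonempty[OF assms(1,3)] by auto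
  have cl: "fv (embed_fm B) = {}"
    using sentence_PEM[OF assms(4)] by (simp add: sentence_def)
  \<comment> \<open>The hull needs an assignment into the domain, which \<open>e\<close> need not
    be; for the sentence \<open>B\<close> a constant one serves.\<close>
  have ref: "\<not> force M w (\<lambda>_. d) (embed_fm B)"
    using assms(5) force_closed[OF cl, of M w e "\<lambda>_. d"] by simp
  interpret skolem_hull L M w "\<lambda>_. d"
    using assms(1,3) d by unfold_locales auto
  let ?P = "\<lambda>n. \<exists>N::('f, 'p) small_kripke. kripke_model L N \<and> has_depth N n \<and> refutes N B"
  obtain n where n: "n \<le> 1" "has_depth hull n"
    using has_depth_of_chains_bounded[OF kripke_model_hull chains_bounded_hull[OF assms(2)]] by auto
  have Pn: "?P n"
    using n(2) kripke_model_hull refutes_hull[OF ref] by blast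
  have P0: "\<not> ?P 0"
  proof
    assume "?P 0"
    then obtain N :: "('f, 'p) small_kripke" and v e'
      where N: "kripke_model L N" "has_depth N 0" "v \<in> Nodes N" "\<not> force N v e' (embed_fm B)"
      by (auto simp: refutes_def forces_def)
    then show False
      using end_node_forces_PEM[OF N(1,3) assms(4) has_depth_0_end_node[OF N(1-3)]] by blast
  qed
  have "n = 1"
    using n(1) Pn P0 by (cases n) auto
  have "(LEAST n. ?P n) = 1"
  proof (rule Least_equality)
    show "?P 1"
      using Pn \<open>n = 1\<close> by simp
    show "1 \<le> m" if "?P m" for m
      using that P0 by (cases m) auto
  qed
  then have "kripke_rank L B = Fin 1"
    unfolding kripke_rank_def using Pn by auto
  then show ?thesis
    using assms(4) by (simp add: PEM1_def)
qed

section \<open>Reaching a classical node by cutting\<close>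

text \<open>If all proper successors of \<open>b\<close> are classical, then flattening the order above \<open>b\<close> to depth 1
  does not change what is forced at \<open>b\<close>.\<close>

lemma force_flattened:
  assumes M: "kripke_model L M" and b: "b \<in> Nodes M"
    and cl: "\<And>v. (b, v) \<in> Leq M \<Longrightarrow> v \<noteq> b \<Longrightarrow> classical_node L M v"
    and S: "S = {v. (b, v) \<in> Leq M}" and R: "R = Id_on S \<union> {b} \<times> S"
  shows "wf_fm L A \<Longrightarrow> v \<in> S \<Longrightarrow> range e \<subseteq> Dom M v \<Longrightarrow>
    force (reframe M S R) v e (embed_fm A) = force M v e (embed_fm A)"
proof (induction A arbitrary: v e)
  case (Imp A B)
  show ?case
  proof (cases "v = b")
    case True
    have "force (reframe M S R) u e (embed_fm A) = force M u e (embed_fm A)"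
      "force (reframe M S R) u e (embed_fm B) = force M u e (embed_fm B)" if "(b, u) \<in> Leq M" for u
      using that Imp True kripke_model_Dom_mono[OF M that] S by auto
    moreover have "(b, u) \<in> R \<longleftrightarrow> (b, u) \<in> Leq M" for u
      using R S kripke_model_refl[OF M b] by auto
    ultimately show ?thesis
      using True by simp
  next
    case False
    \<comment> \<open>Now \<open>v\<close> is an end node of the flattened order, where forcing is
      truth. In \<open>M\<close> it is classical, so forcing is truth there as well.\<close>
    have "(v, u) \<in> Leq (reframe M S R) \<longleftrightarrow> u = v" for u
      using False R Imp.prems(2) by auto
    then have "force (reframe M S R) v e (embed_fm (Imp A B)) = holds M v e (embed_fm (Imp A B))"
      using force_eq_holds_at_end_node[of v "reframe M S R" e "embed_fm (Imp A B)"]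
      by (simp only: holds_reframe)
    moreover have "force M v e (embed_fm (Imp A B)) = holds M v e (embed_fm (Imp A B))"
      using Imp.prems False S kripke_model_Leq_Nodes(2)[OF M, of b v]
      by (intro classical_node_force_eq_holds[OF M]) (auto intro!: cl)
    ultimately show ?thesis by simp
  qed
next
  case (Forall x A)
  show ?case
  proof (cases "v = b")
    case True
    have "force (reframe M S R) u (e(x := d)) (embed_fm A) = force M u (e(x := d)) (embed_fm A)"
      if u: "(b, u) \<in> Leq M" and d: "d \<in> Dom M u" for u d
    proof (rule Forall.IH)
      show "range (e(x := d)) \<subseteq> Dom M u"
        using Forall.prems(3) True kripke_model_Dom_mono[OF M u] d by (intro range_fun_upd) auto
    qed (use Forall.prems u S in auto)
    moreover have "(b, u) \<in> R \<longleftrightarrow> (b, u) \<in> Leq M" for u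
      using R S kripke_model_refl[OF M b] by auto
    ultimately show ?thesis
      using True by (simp cong: ball_cong)
  next
    case False
    have "(v, u) \<in> Leq (reframe M S R) \<longleftrightarrow> u = v" for u
      using False R Forall.prems(2) by auto
    then have "force (reframe M S R) v e (embed_fm (Forall x A))
        = holds M v e (embed_fm (Forall x A))"
      using force_eq_holds_at_end_node[of v "reframe M S R" e "embed_fm (Forall x A)"]
      by (simp only: holds_reframe)
    moreover have "force M v e (embed_fm (Forall x A)) = holds M v e (embed_fm (Forall x A))"
      using Forall.prems False S kripke_model_Leq_Nodes(2)[OF M, of b v]
      by (intro classical_node_force_eq_holds[OF M]) (auto intro!: cl)
    ultimately show ?thesis by simp
  qed
next
  case (Exists x A)
  have "force (reframe M S R) v (e(x := d)) (embed_fm A) = force M v (e(x := d)) (embed_fm A)"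
    if d: "d \<in> Dom M v" for d
    using Exists.prems(1,2) range_fun_upd[OF Exists.prems(3) d] by (intro Exists.IH) simp_all
  then show ?case
    by (simp cong: bex_cong)
qed auto

text \<open>The instance is taken from a maximal non-classical node \<open>b\<close> above
  \<open>a\<close>, since there flattening certifies rank 1. By persistence it is not forced at
  \<open>a\<close> either.\<close>

lemma ex_unforced_PEM1:
  assumes M: "kripke_model L M" "chains_bounded M n" and a: "a \<in> Nodes M"
    and ncl: "\<not> classical_node L M a"
  shows "\<exists>B\<in>PEM1 L. a \<in> unforced M B"
proof -
  let ?Q = "{v. (a, v) \<in> Leq M \<and> \<not> classical_node L M v}"
  have "?Q \<subseteq> Nodes M" "?Q \<noteq> {}"
    using kripke_model_Leq_Nodes(2)[OF M(1)] kripke_model_refl[OF M(1) a] ncl by auto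
  then obtain b where b: "(a, b) \<in> Leq M" "\<not> classical_node L M b"
    and max: "\<And>v. (b, v) \<in> Leq M \<Longrightarrow> v \<noteq> b \<Longrightarrow> v \<notin> ?Q"
    using chains_bounded_maximal[OF M] by blast
  have bN: "b \<in> Nodes M"
    by (rule kripke_model_Leq_Nodes(2)[OF M(1) b(1)])
  have cl: "classical_node L M v" if "(b, v) \<in> Leq M" "v \<noteq> b" for v
    using max[OF that] kripke_model_trans[OF M(1) b(1) that(1)] by simp
  obtain B e where B: "B \<in> PEM L" "\<not> force M b e (embed_fm B)"
    using b(2) by (auto simp: classical_node_def)
  have sB: "sentence L B"
    by (rule sentence_PEM[OF B(1)])
  obtain d where d: "d \<in> Dom M b"
    using kripke_model_Dom_nonempty[OF M(1) bN] by auto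
  define S where "S = {v. (b, v) \<in> Leq M}"
  define R where "R = Id_on S \<union> {b} \<times> S"
  have bS: "b \<in> S"
    using kripke_model_refl[OF M(1) bN] by (simp add: S_def)
  have "partial_order_on S R"
    using bS unfolding partial_order_on_def preorder_on_def refl_on_def antisym_def trans_def R_def
    by auto
  moreover have "S \<subseteq> Nodes M" "R \<subseteq> Leq M"
    using kripke_model_Leq_Nodes(2)[OF M(1)] kripke_model_refl[OF M(1)] by (auto simp: S_def R_def)
  ultimately have K: "kripke_model L (reframe M S R)"
    using bS by (intro kripke_model_reframe[OF M(1)]) auto
  have "chains_bounded (reframe M S R) (Suc (Suc 0))"
    unfolding chains_bounded_def
  proof
    fix C
    assume "C \<in> Chains (Leq (reframe M S R))"
    then have C: "x = b \<or> y = b \<or> x = y" if "x \<in> C" "y \<in> C" for x y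
      using that unfolding Chains_def R_def by auto
    \<comment> \<open>Two elements of \<open>C\<close> other than \<open>b\<close> would
      coincide.\<close>
    have "\<exists>y. C \<subseteq> {b, y}"
      using C by blast
    then obtain y where y: "C \<subseteq> {b, y}" by blast
    then have "card C \<le> card {b, y}"
      by (intro card_mono) auto
    also have "\<dots> \<le> Suc (Suc 0)"
      by (simp add: card_insert_if)
    finally show "finite C \<and> card C \<le> Suc (Suc 0)"
      using y finite_subset by auto
  qed
  moreover have "\<not> force (reframe M S R) b (\<lambda>_. d) (embed_fm B)"
  proof -
    have "force (reframe M S R) b (\<lambda>_. d) (embed_fm B) = force M b (\<lambda>_. d) (embed_fm B)"
      using sB bS d by (intro force_flattened[OF M(1) bN cl S_def R_def]) (auto simp: sentence_def)
    also have "\<dots> = force M b e (embed_fm B)"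
      using sB by (intro force_closed) (simp add: sentence_def)
    finally show ?thesis using B(2) by simp
  qed
  ultimately have "B \<in> PEM1 L"
    using PEM1_if_refuted[OF K] bS B(1) by simp
  moreover have "a \<in> unforced M B"
    using a B(2) sentence_force_mono[OF M(1) sB b(1)] by (auto simp: unforced_def)
  ultimately show ?thesis by blast
qed

text \<open>Each cut by an instance of PEM lowers the bound on chains, so cutting ends, with
  \<open>a\<close> still present and classical. The model varies in the induction, as the hypothesis
  is applied to the cut model.\<close>

lemma ex_classical_cutoff:
  "kripke_model L M \<Longrightarrow> chains_bounded M n \<Longrightarrow> a \<in> Nodes M \<Longrightarrow>
    \<exists>\<rho>\<in>friedman_star (PEM1 L). sentence L \<rho> \<and> a \<in> unforced M \<rho> \<and> classical_node L (cutoff M \<rho>) a"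
proof (induction n arbitrary: M)
  case 0
  \<comment> \<open>The bound 0 is impossible, because \<open>a\<close> alone forms a chain.\<close>
  have "{a} \<in> Chains (Leq M)"
    using kripke_model_refl[OF 0(1,3)] by (simp add: Chains_def)
  then show ?case
    using 0(2) by (auto simp: chains_bounded_def)
next
  case (Suc n)
  show ?case
  proof (cases "classical_node L M a")
    case True
    have "Bot \<in> friedman_star (PEM1 L)"
      unfolding friedman_star_def by (rule UN_I[of 0]) auto
    then show ?thesis
      using True Suc.prems cutoff_Bot[OF Suc.prems(1)]
      by (intro bexI[of _ Bot]) (auto simp: sentence_def unforced_def)
  next
    case False
    then obtain B where B: "B \<in> PEM1 L" "a \<in> unforced M B"
      using ex_unforced_PEM1[OF Suc.prems] by blast
    then have BP: "B \<in> PEM L"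
      by (simp add: PEM1_def)
    have sB: "sentence L B"
      by (rule sentence_PEM[OF BP])
    have "kripke_model L (cutoff M B)"
      using B(2) by (intro kripke_model_cutoff[OF Suc.prems(1)]) auto
    then obtain \<rho> where \<rho>: "\<rho> \<in> friedman_star (PEM1 L)" "sentence L \<rho>" "a \<in> unforced (cutoff M B) \<rho>"
      "classical_node L (cutoff (cutoff M B) \<rho>) a"
      using Suc.IH[OF _ chains_bounded_cutoff[OF Suc.prems(1) BP Suc.prems(2)]] B(2) by auto
    obtain k where "\<rho> \<in> friedman_pow (PEM1 L) k"
      using \<rho>(1) by (auto simp: friedman_star_def)
    \<comment> \<open>Cutting by \<open>B\<close> and then by \<rho> is cutting by
      \<open>friedman \<rho> B\<close>, which has the shape prescribed by
      \<open>friedman_pow\<close>.\<close>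
    then have "friedman \<rho> B \<in> friedman_pow (PEM1 L) (Suc k)"
      using B(1) by auto
    then have "friedman \<rho> B \<in> friedman_star (PEM1 L)"
      unfolding friedman_star_def by blast
    moreover have "sentence L (friedman \<rho> B)"
      by (rule sentence_friedman[OF \<rho>(2) sB])
    moreover have "a \<in> unforced M (friedman \<rho> B)"
      using \<rho>(3) arg_cong[OF cutoff_friedman[OF Suc.prems(1) sB], of Nodes \<rho>] by simp
    ultimately show ?thesis
      using \<rho>(4) unfolding cutoff_friedman[OF Suc.prems(1) sB, symmetric] by blast
  qed
qed

section \<open>Eliminating constants\<close>

text \<open>Variables of a formula of \<open>L(D)\<close> become even variables, its constants odd ones.\<close>

fun unconst_trm :: "('d \<Rightarrow> nat) \<Rightarrow> ('f + 'd) trm \<Rightarrow> 'f trm" where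
  "unconst_trm i (Var x) = Var (2 * x)"
| "unconst_trm i (App (Inl f) ts) = App f (map (unconst_trm i) ts)"
| "unconst_trm i (App (Inr d) ts) = Var (2 * i d + 1)"

primrec unconst :: "('d \<Rightarrow> nat) \<Rightarrow> ('f + 'd, 'p) fm \<Rightarrow> ('f, 'p) fm" where
  "unconst i Bot = Bot"
| "unconst i (Atom p ts) = Atom p (map (unconst_trm i) ts)"
| "unconst i (And A B) = And (unconst i A) (unconst i B)"
| "unconst i (Or A B) = Or (unconst i A) (unconst i B)"
| "unconst i (Imp A B) = Imp (unconst i A) (unconst i B)"
| "unconst i (Forall x A) = Forall (2 * x) (unconst i A)"
| "unconst i (Exists x A) = Exists (2 * x) (unconst i A)"

text \<open>Under this assignment \<open>unconst i A\<close> means what \<open>A\<close> means under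
  \<open>e\<close>, provided \<open>k\<close> undoes \<open>i\<close> on the constants of
  \<open>A\<close>.\<close>

definition interleave :: "(nat \<Rightarrow> 'd) \<Rightarrow> (nat \<Rightarrow> 'd) \<Rightarrow> nat \<Rightarrow> 'd" where
  "interleave e k n = (if even n then e (n div 2) else k (n div 2))"

lemma interleave_upd: "(interleave e k)(2 * x := b) = interleave (e(x := b)) k"
  by (auto simp: interleave_def fun_eq_iff)

lemma val_unconst:
  "(\<And>d. Inr d \<in> set_trm t \<Longrightarrow> k (i d) = d) \<Longrightarrow>
    val M w (interleave e k) (map_trm Inl (unconst_trm i t)) = val M w e t"
proof (induction i t rule: unconst_trm.induct)
  case (2 i f ts)
  then have "map (val M w (interleave e k) \<circ> (map_trm Inl \<circ> unconst_trm i)) ts = map (val M w e) ts"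
    by auto
  then show ?case by (simp del: map_eq_conv)
qed (auto simp: interleave_def)

lemma map_val_unconst:
  "(\<And>d. Inr d \<in> set1_fm (Atom p ts) \<Longrightarrow> k (i d) = d) \<Longrightarrow>
    map (val M w (interleave e k)) (map (map_trm Inl) (map (unconst_trm i) ts)) = map (val M w e) ts"
  by (auto intro!: val_unconst)

lemma force_unconst:
  "(\<And>d. Inr d \<in> set1_fm A \<Longrightarrow> k (i d) = d) \<Longrightarrow>
    force M w (interleave e k) (embed_fm (unconst i A)) = force M w e A"
proof (induction A arbitrary: w e)
  case (Atom p ts)
  then show ?case
    using map_val_unconst[of p ts k i M w e] by (simp del: map_map map_eq_conv)
qed (simp_all add: interleave_upd)

lemma holds_unconst:
  "(\<And>d. Inr d \<in> set1_fm A \<Longrightarrow> k (i d) = d) \<Longrightarrow>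
    holds M w (interleave e k) (embed_fm (unconst i A)) = holds M w e A"
proof (induction A arbitrary: e)
  case (Atom p ts)
  then show ?case
    using map_val_unconst[of p ts k i M w e] by (simp del: map_map map_eq_conv)
qed (simp_all add: interleave_upd)

lemma wf_unconst_trm: "wf_trm (with_consts L D) t \<Longrightarrow> wf_trm L (unconst_trm i t)"
  by (induction i t rule: unconst_trm.induct) (auto simp: with_consts_def)

lemma Preds_with_consts [simp]: "Preds (with_consts L D) = Preds L"
  by (simp add: with_consts_def)

lemma wf_unconst: "wf_fm (with_consts L D) A \<Longrightarrow> wf_fm L (unconst i A)"
  by (induction A) (auto intro: wf_unconst_trm)

lemma wf_trm_consts: "wf_trm (with_consts L D) t \<Longrightarrow> Inr d \<in> set_trm t \<Longrightarrow> d \<in> D"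
  by (induction t) (auto simp: with_consts_def)

lemma wf_fm_consts: "wf_fm (with_consts L D) A \<Longrightarrow> Inr d \<in> set1_fm A \<Longrightarrow> d \<in> D"
  by (induction A) (auto dest: wf_trm_consts)

lemma finite_set_trm: "finite (set_trm t)"
  by (induction t) auto

lemma finite_set1_fm: "finite (set1_fm A)"
  by (induction A) (auto simp: finite_set_trm)

text \<open>PEM is available for formulas of \<open>L\<close> only. The finitely many constants of
  \<open>A\<close> are traded for variables carrying their values, and
  \<open>classical_node_force_eq_holds\<close> admits every assignment into the domain.\<close>

lemma classical_node_force_eq_holds_consts:
  assumes "kripke_model L M" "a \<in> Nodes M" "classical_node L M a"
    and "wf_fm (with_consts L (Dom M a)) A" "range e \<subseteq> Dom M a"
  shows "force M a e A = holds M a e A"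
proof -
  let ?C = "Inr -` set1_fm A"
  have "finite ?C"
    by (intro finite_vimageI finite_set1_fm) simp
  then obtain i :: "'d \<Rightarrow> nat" where i: "inj_on i ?C"
    using finite_imp_inj_to_nat_seg by blast
  have C: "?C \<subseteq> Dom M a"
    using wf_fm_consts[OF assms(4)] by auto
  \<comment> \<open>The default \<open>e 0\<close> keeps all values inside
    \<open>Dom M a\<close>.\<close>
  define k where "k = (\<lambda>n. if n \<in> i ` ?C then inv_into ?C i n else e 0)"
  have k: "k (i d) = d" if "Inr d \<in> set1_fm A" for d
    using that i by (simp add: k_def)
  have "k n \<in> Dom M a" for n
    using C assms(5) inv_into_into[of n i ?C] by (auto simp: k_def)
  then have "range (interleave e k) \<subseteq> Dom M a"
    using assms(5) by (auto simp: interleave_def)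
  from classical_node_force_eq_holds[OF assms(1-3) wf_unconst[OF assms(4)] this]
  show ?thesis
    using force_unconst[of A k i M a e, OF k] holds_unconst[of A k i M a e, OF k] by simp
qed

theorem mainTheorem3:
  fixes L :: "('f, 'p) lang"
    and M :: "('f, 'p, 'w, 'd) kripke"
  assumes "kripke_model L M"
    and "finite_depth M"
  shows "\<forall>\<alpha>\<in>Nodes M. \<exists>\<rho>\<in>friedman_star (PEM1 L).
    \<forall>A. sentence (with_consts L (Dom M \<alpha>)) A \<longrightarrow>
      (forces M \<alpha> (friedman A (embed_fm \<rho>)) \<longleftrightarrow> models_at M \<alpha> A)"
proof
  fix a
  assume a: "a \<in> Nodes M"
  obtain n where "chains_bounded M n"
    using assms(2) by (auto simp: finite_depth_def has_depth_def chains_bounded_def)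
  then obtain \<rho> where \<rho>: "\<rho> \<in> friedman_star (PEM1 L)" "sentence L \<rho>" "a \<in> unforced M \<rho>"
    "classical_node L (cutoff M \<rho>) a"
    using ex_classical_cutoff[OF assms(1) _ a] by blast
  have K: "kripke_model L (cutoff M \<rho>)"
    using \<rho>(3) by (intro kripke_model_cutoff[OF assms(1)]) auto
  \<comment> \<open>Since \<open>a\<close> survives the cut, forcing the translation in
    \<open>M\<close> is forcing \<open>A\<close> in \<open>cutoff M \<rho>\<close>; there
    \<open>a\<close> is classical, and truth at \<open>a\<close> is the same in both models.\<close>
  have "force M a e (friedman A (embed_fm \<rho>)) = holds M a e A"
    if "sentence (with_consts L (Dom M a)) A" "range e \<subseteq> Dom M a" for A e
    using classical_node_force_eq_holds_consts[OF K _ \<rho>(4), of A e] that \<rho>(3)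
      force_friedman[OF assms(1) \<rho>(2) a, of e A] by (simp add: sentence_def)
  then show "\<exists>\<rho>\<in>friedman_star (PEM1 L). \<forall>A. sentence (with_consts L (Dom M a)) A \<longrightarrow>
      (forces M a (friedman A (embed_fm \<rho>)) \<longleftrightarrow> models_at M a A)"
    using \<rho>(1) by (intro bexI[of _ \<rho>]) (auto simp: forces_def models_at_def)
qed

end
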